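(* Let $n\ge 2$ and let $D, D'\subset\mathbb C^n$ be bounded quasi-circular domains containing the origin, whose weights (possibly different from each other) both belong to $\mathscr L_n$. Then every biholomorphism $f: D\to D'$ with $f(0)=0$ is linear, i.e. is the restriction to $D$ of a $\mathbb C$-linear map $\mathbb C^n\to\mathbb C^n$.
   Context: A weight is a tuple of positive integers $(m_1,\ldots,m_n)$ with $\gcd(m_1,\ldots,m_n)=1$ and (standing assumption here) $m_1<m_2<\cdots<m_n$. A domain (connected open set) $D\subset\mathbb C^n$ is quasi-circular with weight $(m_1,\ldots,m_n)$ if for every $\theta\in\mathbb R$ it is invariant under the map $(z_1,\ldots,z_n)\mapsto(e^{im_1\theta}z_1,\ldots,e^{im_n\theta}z_n)$. All domains are assumed bounded and to contain the origin. For an integer $\ell\ge 1$, positive integers $m_1<\cdots<m_\ell$, an index $1\le i\le \ell$, and $k=(k_1,\ldots,k_\ell)\in\mathbb Z_{\ge0}^\ell$, put $r^{\ell}_{k,m,i}:=m_i+\sum_{q=1}^{\ell}m_qk_q$. For an integer $M\ge1$ put $$I^{\ell}_{m,M}:=\Big\{r^{\ell}_{k,m,i}:\ 1\le i\le \ell,\ k\in\mathbb Z_{\ge 0}^{\ell},\ k\neq(0,\ldots,0),\ (M-1)\sum_{q=1}^{\ell}m_q<r^{\ell}_{k,m,i}<M\sum_{q=1}^{\ell}m_q\Big\}.$$ The sets $\mathscr L_n$ of strictly increasing $n$-tuples of positive integers are defined recursively. $\mathscr L_2$ is the set of $(m_1,m_2)$ with $m_1<m_2$, $m_1\ge2$ and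 $m_2\not\equiv0\pmod{m_1}$. For $n\ge3$, $\mathscr L_n$ is the set of $(m_1,\ldots,m_n)$ with $m_1<\cdots<m_n$ such that (i) $(m_1,\ldots,m_{n-1})\in\mathscr L_{n-1}$, and (ii) there is an integer $M_n\ge1$ with $(M_n-1)\sum_{q=1}^{n-1}m_q<m_n<M_n\sum_{q=1}^{n-1}m_q$ and $m_n\notin I^{n-1}_{m,M_n}$. (No gcd condition is imposed on the shorter tuples in the recursion; the gcd condition is imposed only on the weight of the domain.) *)

theory Defs
  imports "HOL-Analysis.Analysis"
begin

text \<open>
  An \<open>n\<close>-tuple \<open>(m\<^sub>1, \<dots>, m\<^sub>n)\<close> is a function \<^typ>\<open>nat \<Rightarrow> nat\<close> of which only the values at
  \<open>1, \<dots>, n\<close> matter, so that its initial segment of length \<open>n - 1\<close> is the same function.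
\<close>

definition is_weight :: "nat \<Rightarrow> (nat \<Rightarrow> nat) \<Rightarrow> bool" where
  "is_weight n m \<longleftrightarrow>
     (\<forall>i\<in>{1..n}. 0 < m i) \<and> Gcd (m ` {1..n}) = 1 \<and> strict_mono_on {1..n} m"

definition r_index :: "nat \<Rightarrow> (nat \<Rightarrow> nat) \<Rightarrow> (nat \<Rightarrow> nat) \<Rightarrow> nat \<Rightarrow> nat" where
  "r_index l k m i = m i + (\<Sum>q=1..l. m q * k q)"

definition I_set :: "nat \<Rightarrow> (nat \<Rightarrow> nat) \<Rightarrow> nat \<Rightarrow> nat set" where
  "I_set l m M =
     {r_index l k m i | i k. i \<in> {1..l} \<and> (\<exists>q\<in>{1..l}. k q \<noteq> 0) \<and>
        (M - 1) * (\<Sum>q=1..l. m q) < r_index l k m i \<and>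
        r_index l k m i < M * (\<Sum>q=1..l. m q)}"

text \<open>The values at lengths \<open>0\<close> and \<open>1\<close> are junk.\<close>

fun L_set :: "nat \<Rightarrow> (nat \<Rightarrow> nat) set" where
  "L_set 0 = {}"
| "L_set (Suc 0) = {}"
| "L_set (Suc (Suc 0)) = {m. m 1 < m 2 \<and> 2 \<le> m 1 \<and> m 2 mod m 1 \<noteq> 0}"
| "L_set (Suc (Suc (Suc p))) =
     (let n = p + 3 in
      {m. strict_mono_on {1..n} m \<and> m \<in> L_set (Suc (Suc p)) \<and>
          (\<exists>M\<ge>1. (M - 1) * (\<Sum>q=1..n-1. m q) < m n \<and> m n < M * (\<Sum>q=1..n-1. m q) \<and>
                 m n \<notin> I_set (n - 1) m M)})"

text \<open>
  The coordinates of \<^typ>\<open>complex^'n\<close> are numbered \<open>1, \<dots>, n\<close> along the linear order of the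
  index type, \<open>n\<close> being its cardinality.
\<close>

definition pos :: "'n::{finite,linorder} \<Rightarrow> nat" where
  "pos i = card {j. j \<le> i}"

lemma strict_mono_pos: "strict_mono (pos :: 'n::{finite,linorder} \<Rightarrow> nat)"
proof (rule strict_monoI)
  fix x y :: 'n
  assume "x < y"
  then have "{j. j \<le> x} \<subset> {j. j \<le> y}"
    by (metis (mono_tags, lifting) atMost_def atMost_subset_iff less_le_not_le psubsetI)
  then show "pos x < pos y"
    unfolding pos_def by (intro psubset_card_mono) simp_all
qed

lemma bij_betw_pos: "bij_betw (pos :: 'n::{finite,linorder} \<Rightarrow> nat) UNIV {1..CARD('n)}"
proof -
  have inj: "inj (pos :: 'n \<Rightarrow> nat)"
    using strict_mono_pos by (rule strict_mono_imp_inj_on)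
  have "range (pos :: 'n \<Rightarrow> nat) \<subseteq> {1..CARD('n)}"
    by (auto simp: pos_def Suc_le_eq card_gt_0_iff intro!: card_mono)
  moreover have "card (range (pos :: 'n \<Rightarrow> nat)) = card {1..CARD('n)}"
    using inj by (simp add: card_image)
  ultimately have "range (pos :: 'n \<Rightarrow> nat) = {1..CARD('n)}"
    by (intro card_subset_eq) auto
  with inj show ?thesis
    by (simp add: bij_betw_def)
qed

definition quasi_rotation ::
  "(nat \<Rightarrow> nat) \<Rightarrow> real \<Rightarrow> complex^'n::{finite,linorder} \<Rightarrow> complex^'n::{finite,linorder}" where
  "quasi_rotation m \<theta> z = (\<chi> i. exp (\<i> * of_nat (m (pos i)) * of_real \<theta>) * z $ i)"

definition quasi_circular ::
  "(nat \<Rightarrow> nat) \<Rightarrow> (complex^'n::{finite,linorder}) set \<Rightarrow> bool" where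
  "quasi_circular m D \<longleftrightarrow>
     open D \<and> connected D \<and> is_weight CARD('n) m \<and> (\<forall>\<theta>. quasi_rotation m \<theta> ` D = D)"

text \<open>
  Holomorphy in several variables is complex Frechet differentiability: \<open>has_derivative\<close> by itself
  only gives a real-linear derivative.
\<close>

definition holomorphic_map_on ::
  "(complex^'n \<Rightarrow> complex^'k) \<Rightarrow> (complex^'n) set \<Rightarrow> bool" where
  "holomorphic_map_on f S \<longleftrightarrow>
     (\<forall>z\<in>S. \<exists>A. Vector_Spaces.linear (*s) (*s) A \<and> (f has_derivative A) (at z))"

definition biholomorphism_on ::
  "(complex^'n \<Rightarrow> complex^'n) \<Rightarrow> (complex^'n) set \<Rightarrow> (complex^'n) set \<Rightarrow> bool" where
  "biholomorphism_on f D D' \<longleftrightarrow>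
     bij_betw f D D' \<and> holomorphic_map_on f D \<and> holomorphic_map_on (inv_into D f) D'"

end

theory Submission
  imports Defs "HOL-Complex_Analysis.Complex_Analysis"
begin

text \<open>
  The sets \<open>\<L>\<^sub>n\<close> consist of tuples without resonances: no \<open>m\<^sub>i\<close> is a combination
  \<open>\<Sum> \<alpha>\<^sub>q m\<^sub>q\<close> with \<open>|\<alpha>| \<ge> 2\<close>. Hence a homogeneous polynomial map of degree at least \<open>2\<close>
  has mean zero under conjugation by the rotations, and vanishes if it commutes with them.

  Every automorphism of \<open>D\<close> that fixes \<open>0\<close> is linear, by induction on the degree \<open>k \<ge> 2\<close>. If the
  parts of degree \<open>2, \<dots>, k - 1\<close> of all automorphisms vanish, the parts of degree \<open>k\<close>,
  normalized by the derivatives, form a cocycle on the automorphism group with values in a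
  finite-dimensional space. It is bounded by Cauchy's inequality and zero on the rotations, and if
  it were nonzero somewhere, repeated composition with random rotations would make its mean square
  grow without bound.

  For \<open>f : D \<rightarrow> D'\<close> the automorphisms \<open>f\<^sup>-\<^sup>1 \<circ> R'\<^sub>\<theta> \<circ> f\<close> of \<open>D\<close> are therefore linear. So
  \<open>f\<close>, precomposed with the inverse of its derivative at \<open>0\<close>, commutes with the rotations
  \<open>R'\<^sub>\<theta>\<close> of \<open>D'\<close> near \<open>0\<close>, and its parts of degree at least \<open>2\<close> vanish.
\<close>

no_notation fps_nth (infixl \<open>$\<close> 75)

section \<open>Absence of resonances\<close>

text \<open>The recursion keeps the function \<open>m\<close> and shortens only the length, so one
  descends from \<open>n\<close>; \<open>2 \<le> i\<close> keeps clear of the junk lengths.\<close>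

lemma L_set_init:
  assumes "m \<in> L_set n" "2 \<le> i" "i \<le> n"
  shows "m \<in> L_set i"
  using assms
proof (induction n rule: L_set.induct)
  case (4 p)
  show ?case
  proof (cases "i = Suc (Suc (Suc p))")
    case False
    then show ?thesis using 4 by (auto simp: Let_def)
  qed (use 4 in simp)
qed (auto simp: le_Suc_eq)

text \<open>Taking one unit off a positive entry \<open>\<alpha> j\<close> leaves a nonzero
  \<open>k\<close>, since the total is at least 2. The combination then has the form
  \<open>r_index l k m j\<close>, and its value would lie in \<open>I_set\<close>. For
  \<open>i = 2\<close> it is a multiple of \<open>m 1\<close>, which the base case forbids.\<close>

lemma L_set_not_combination:
  assumes "m \<in> L_set i" and "2 \<le> (\<Sum>q=1..i-1. \<alpha> q)"
  shows "m i \<noteq> (\<Sum>q=1..i-1. m q * \<alpha> q)"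
proof
  assume eq: "m i = (\<Sum>q=1..i-1. m q * \<alpha> q)"
  show False
    using assms(1)
  proof (cases i rule: L_set.cases)
    case 3
    then show False using assms(1) eq by (simp add: numeral_2_eq_2)
  next
    case (4 p)
    define l where "l = Suc (Suc p)"
    have i: "i - 1 = l" and il: "i = Suc l" using 4 by (simp_all add: l_def)
    obtain M where M: "(M - 1) * (\<Sum>q=1..l. m q) < m i" "m i < M * (\<Sum>q=1..l. m q)"
        "m i \<notin> I_set l m M"
      using assms(1) unfolding 4 by (auto simp: Let_def l_def eval_nat_numeral)
    obtain j where j: "j \<in> {1..l}" "\<alpha> j \<noteq> 0"
      using assms(2) unfolding i by (metis (no_types, lifting) not_numeral_le_zero sum.neutral)
    define k where "k = \<alpha>(j := \<alpha> j - 1)"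
    have split: "(\<Sum>q=1..l. w q) = w j + (\<Sum>q\<in>{1..l}-{j}. w q)" for w :: "nat \<Rightarrow> nat"
      using j(1) by (simp add: sum.remove)
    have rest: "(\<Sum>q\<in>{1..l}-{j}. m q * k q) = (\<Sum>q\<in>{1..l}-{j}. m q * \<alpha> q)"
      by (intro sum.cong) (auto simp: k_def)
    have "m j + m j * (\<alpha> j - 1) = m j * \<alpha> j"
      using j(2) by (cases "\<alpha> j") auto
    then have r: "r_index l k m j = m i"
      unfolding r_index_def eq i split[of "\<lambda>q. m q * k q"] split[of "\<lambda>q. m q * \<alpha> q"] rest
      by (simp add: k_def)
    have "\<exists>q\<in>{1..l}. k q \<noteq> 0"
    proof (rule ccontr)
      assume "\<not> ?thesis"
      then have z: "\<And>q. q \<in> {1..l} \<Longrightarrow> k q = 0" by blast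
      have "(\<Sum>q\<in>{1..l}-{j}. \<alpha> q) = (\<Sum>q\<in>{1..l}-{j}. k q)"
        by (intro sum.cong) (auto simp: k_def)
      also have "\<dots> = 0" using z by simp
      finally have "(\<Sum>q=1..l. \<alpha> q) = \<alpha> j" using split[of \<alpha>] by simp
      moreover have "\<alpha> j \<le> 1" using z[OF j(1)] by (simp add: k_def)
      ultimately show False using assms(2) i by simp
    qed
    then have "m i \<in> I_set l m M"
      unfolding I_set_def mem_Collect_eq
      by (intro exI[of _ j] exI[of _ k]) (use M(1,2) j(1) r in simp)
    then show False using M(3) by blast
  qed auto
qed

text \<open>Since the weights increase, only indices before \<open>i\<close> can occur in a
  combination of total degree at least 2; renumbering these along \<open>pos\<close> reduces the
  claim to \<open>L_set_not_combination\<close>.\<close>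

lemma L_set_no_resonance:
  fixes \<alpha> :: "'n::{finite,linorder} \<Rightarrow> nat"
  assumes "m \<in> L_set CARD('n)" "is_weight CARD('n) m" "2 \<le> sum \<alpha> UNIV"
  shows "m (pos (i::'n)) \<noteq> (\<Sum>j\<in>UNIV. m (pos j) * \<alpha> j)"
proof
  assume eq: "m (pos i) = (\<Sum>j\<in>UNIV. m (pos j) * \<alpha> j)"
  have pos: "0 < m q" if "q \<in> {1..CARD('n)}" for q
    using assms(2) that by (auto simp: is_weight_def)
  have mono: "strict_mono_on {1..CARD('n)} m"
    using assms(2) by (auto simp: is_weight_def)
  have pin: "pos j \<in> {1..CARD('n)}" for j :: 'n
    using bij_betw_pos bij_betwE by blast
  \<comment> \<open>If \<open>\<alpha> j \<ge> 1\<close>, then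
    \<open>m (pos j) * \<alpha> j \<le> m (pos i) \<le> m (pos j)\<close> leaves room for nothing
    else: \<open>\<alpha> j = 1\<close> and all other entries vanish, against the total
    degree.\<close>
  have zero: "\<alpha> j = 0" if "i \<le> j" for j :: 'n
  proof (rule ccontr)
    assume "\<alpha> j \<noteq> 0"
    then have aj: "\<alpha> j \<ge> 1" by simp
    have "pos i \<le> pos j"
      using that by (simp add: strict_mono_less_eq[OF strict_mono_pos])
    then have mle: "m (pos i) \<le> m (pos j)"
      using mono pin by (metis strict_mono_on_leD)
    have s: "(\<Sum>j\<in>UNIV. w j) = w j + (\<Sum>q\<in>UNIV-{j}. w q)" for w :: "'n \<Rightarrow> nat"
      by (simp add: sum.remove)
    have le: "m (pos j) * \<alpha> j + (\<Sum>q\<in>UNIV-{j}. m (pos q) * \<alpha> q) \<le> m (pos j)"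
      using eq mle s[of "\<lambda>j. m (pos j) * \<alpha> j"] by simp
    have mp: "0 < m (pos q)" for q :: 'n using pos pin by blast
    have le1: "m (pos j) * \<alpha> j \<le> m (pos j) * 1" using add_leD1[OF le] by simp
    then have "\<alpha> j \<le> 1" using mp[of j] by simp
    then have a1: "\<alpha> j = 1" using aj by simp
    then have "(\<Sum>q\<in>UNIV-{j}. m (pos q) * \<alpha> q) = 0" using le by simp
    then have "m (pos q) * \<alpha> q = 0" if "q \<noteq> j" for q using that by simp
    then have "\<alpha> q = 0" if "q \<noteq> j" for q using that mp[of q] by (metis mult_is_0 neq0_conv)
    then have "sum \<alpha> UNIV = 1" using s[of \<alpha>] a1 by simp
    then show False using assms(3) by simp
  qed
  define \<beta> where "\<beta> q = \<alpha> (inv_into UNIV pos q)" for q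
  have inj: "inj (pos :: 'n \<Rightarrow> nat)" using bij_betw_pos by (auto simp: bij_betw_def)
  have \<beta>: "\<beta> (pos j) = \<alpha> j" for j by (simp add: \<beta>_def inj)
  have set: "pos ` {j. j < i} = {1..pos i - 1}"
  proof -
    have "pos ` {j. j < i} \<subseteq> {1..pos i - 1}"
      using strict_mono_pos[THEN strict_monoD] pin by fastforce
    moreover have "{1..pos i - 1} \<subseteq> pos ` {j. j < i}"
    proof
      fix q assume q: "q \<in> {1..pos i - 1}"
      then have "q \<in> {1..CARD('n)}" using pin[of i] by auto
      then obtain j :: 'n where j: "q = pos j" using bij_betw_pos by (metis bij_betw_imp_surj_on imageE)
      then have "pos j < pos i" using q by auto
      then have "j < i" by (simp add: strict_mono_less[OF strict_mono_pos])
      then show "q \<in> pos ` {j. j < i}" using j by blast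
    qed
    ultimately show ?thesis by blast
  qed
  \<comment> \<open>General in \<open>w\<close>: the constant 1 transfers the total degree,
    \<open>m\<close> the weighted sum.\<close>
  have conv: "(\<Sum>j\<in>UNIV. w (pos j) * \<alpha> j) = (\<Sum>q=1..pos i - 1. w q * \<beta> q)" for w :: "nat \<Rightarrow> nat"
  proof -
    have "(\<Sum>j\<in>UNIV. w (pos j) * \<alpha> j) = (\<Sum>j\<in>{j. j < i}. w (pos j) * \<alpha> j)"
      by (rule sum.mono_neutral_right) (use zero in \<open>auto simp: not_less\<close>)
    also have "\<dots> = (\<Sum>q\<in>pos ` {j. j < i}. w q * \<beta> q)"
      by (subst sum.reindex) (auto simp: \<beta> intro: inj_on_subset[OF inj])
    finally show ?thesis unfolding set .
  qed
  have s2: "2 \<le> (\<Sum>q=1..pos i - 1. \<beta> q)"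
    using conv[of "\<lambda>_. 1"] assms(3) by simp
  \<comment> \<open>For \<open>pos i = 1\<close> the range would be empty and the sum 0.\<close>
  then have "2 \<le> pos i" by (cases "pos i - 1") auto
  then have "m \<in> L_set (pos i)"
    using L_set_init assms(1) pin by (metis atLeastAtMost_iff)
  from L_set_not_combination[OF this s2] show False
    using eq conv[of m] by simp
qed

section \<open>Homogeneous polynomials\<close>

definition root_of_unity :: "nat \<Rightarrow> nat \<Rightarrow> complex" where
  "root_of_unity N j = cis (2 * pi * real j / real N)"

lemma norm_root_of_unity [simp]: "norm (root_of_unity N j) = 1"
  by (simp add: root_of_unity_def)

lemma root_of_unity_nonzero [simp]: "root_of_unity N j \<noteq> 0"
  by (simp add: root_of_unity_def)

lemma root_of_unity_powi:
  "root_of_unity N j powi d = cis (2 * pi * real j * of_int d / real N)"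
  by (simp add: root_of_unity_def cis_power_int mult_ac)

text \<open>A geometric sum whose ratio \<open>w\<close> satisfies \<open>w ^ N = 1\<close>;
  \<open>w = 1\<close> would make \<open>N\<close> divide \<open>d\<close>. The exponents are
  integers because differences of degrees will occur.\<close>

lemma sum_root_of_unity_powi:
  assumes "\<bar>d\<bar> < int N" "d \<noteq> 0"
  shows "(\<Sum>j<N. root_of_unity N j powi d) = 0"
proof -
  define w where "w = cis (2 * pi * of_int d / real N)"
  have N: "N > 0" using assms by (cases N) auto
  have "w \<noteq> 1"
  proof
    assume "w = 1"
    then have "exp (\<i> * complex_of_real (2 * pi * of_int d / real N)) = 1"
      by (simp add: w_def cis_conv_exp)
    then obtain l :: int where "2 * pi * of_int d / real N = of_int (2 * l) * pi"
      by (auto simp: exp_eq_1)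
    then have "of_int d = real N * of_int l" using N by (simp add: field_simps)
    then have "d = int N * l" by (metis of_int_eq_iff of_int_mult of_int_of_nat_eq)
    then have "int N dvd d" by simp
    then show False using assms dvd_imp_le_int[of d "int N"] by auto
  qed
  moreover have "w ^ N = 1"
  proof -
    have "w ^ N = cis (2 * pi * of_int d)" unfolding w_def Complex.DeMoivre using N by (intro arg_cong[of _ _ cis]) simp
    also have "\<dots> = 1" using cis_multiple_2pi[of "of_int d"] by (simp add: mult_ac)
    finally show ?thesis .
  qed
  ultimately have "(\<Sum>j<N. w ^ j) = 0" by (simp add: geometric_sum)
  moreover have "w ^ j = root_of_unity N j powi d" for j
    unfolding root_of_unity_powi w_def Complex.DeMoivre by (simp add: mult_ac)
  ultimately show ?thesis by simp
qed

section \<open>Complex-linear maps\<close>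

lemma scaleR_eq_smult: "r *\<^sub>R z = complex_of_real r *s (z :: complex^'n)"
  by (simp add: vec_eq_iff scaleR_conv_of_real[where 'a = complex])

abbreviation clinear :: "(complex^'n \<Rightarrow> complex^'k) \<Rightarrow> bool" where
  "clinear \<equiv> Vector_Spaces.linear (*s) (*s)"

lemma clinearI:
  assumes "\<And>x y. L (x + y) = L x + L y" "\<And>c x. L (c *s x) = c *s L x"
  shows "clinear L"
  using assms by (simp add: Vector_Spaces.linear_iff vec.vector_space_axioms)

lemma clinearD:
  assumes "clinear L"
  shows "L (x + y) = L x + L y" "L (x - y) = L x - L y" "L (c *s x) = c *s L x" "L 0 = 0"
    "L (sum g I) = (\<Sum>i\<in>I. L (g i))"
proof -
  interpret L: Vector_Spaces.linear "(*s)" "(*s)" L by fact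
  show "L (x + y) = L x + L y" "L (x - y) = L x - L y" "L (c *s x) = c *s L x" "L 0 = 0"
    "L (sum g I) = (\<Sum>i\<in>I. L (g i))"
    by (rule L.add L.diff L.scale L.zero L.sum)+
qed

lemma clinear_compose: "clinear f \<Longrightarrow> clinear g \<Longrightarrow> clinear (\<lambda>z. g (f z))"
  by (intro clinearI) (simp_all add: clinearD)

lemma clinear_bounded_linear: "clinear L \<Longrightarrow> bounded_linear L"
  by (intro linear_conv_bounded_linear[THEN iffD1] linearI) (simp_all only: clinearD scaleR_eq_smult)

text \<open>Polynomials without coefficients: homogeneity, holomorphy on complex lines and growth of
  order \<open>k\<close> are what Cauchy's estimates yield for the parts of a holomorphic function.
  Monomials are recovered in \<open>hom_poly_monomials\<close>.\<close>

definition hom_poly :: "nat \<Rightarrow> (complex^'n \<Rightarrow> complex) \<Rightarrow> bool" where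
  "hom_poly k q \<longleftrightarrow> (\<forall>c z. q (c *s z) = c ^ k * q z) \<and>
     (\<forall>a b. (\<lambda>t. q (a + t *s b)) holomorphic_on UNIV) \<and>
     (\<exists>C. \<forall>z. norm (q z) \<le> C * norm z ^ k)"

lemma norm_vector_smult: "norm (c *s z) = norm c * norm (z :: complex^'n)"
  by (simp add: norm_vec_def norm_mult L2_set_right_distrib)

lemma hom_poly_zero: "hom_poly k (\<lambda>_. 0)"
  by (auto simp: hom_poly_def intro!: exI[of _ 0])

lemma hom_poly_add:
  assumes "hom_poly k p" "hom_poly k q"
  shows "hom_poly k (\<lambda>z. p z + q z)"
proof -
  obtain A B where AB: "\<And>z. norm (p z) \<le> A * norm z ^ k" "\<And>z. norm (q z) \<le> B * norm z ^ k"
    using assms by (auto simp: hom_poly_def)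
  have "norm (p z + q z) \<le> (A + B) * norm z ^ k" for z
    using norm_triangle_ineq[of "p z" "q z"] AB(1)[of z] AB(2)[of z] by (simp add: algebra_simps)
  then have "\<exists>C. \<forall>z. norm (p z + q z) \<le> C * norm z ^ k" by blast
  then show ?thesis
    using assms unfolding hom_poly_def by (auto simp: algebra_simps intro!: holomorphic_intros)
qed

lemma hom_poly_cmult:
  assumes "hom_poly k p"
  shows "hom_poly k (\<lambda>z. c * p z)"
proof -
  obtain A where A: "\<And>z. norm (p z) \<le> A * norm z ^ k"
    using assms by (auto simp: hom_poly_def)
  have "norm (c * p z) \<le> (norm c * A) * norm z ^ k" for z
    using mult_left_mono[OF A[of z], of "norm c"] by (simp add: norm_mult mult_ac)
  then have "\<exists>C. \<forall>z. norm (c * p z) \<le> C * norm z ^ k" by blast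
  then show ?thesis
    using assms unfolding hom_poly_def by (auto simp: algebra_simps intro!: holomorphic_intros)
qed

lemma hom_poly_sum:
  "(\<And>i. i \<in> I \<Longrightarrow> hom_poly k (p i)) \<Longrightarrow> hom_poly k (\<lambda>z. \<Sum>i\<in>I. p i z)"
  by (induction I rule: infinite_finite_induct) (auto intro: hom_poly_zero hom_poly_add)

lemma hom_poly_linear:
  assumes "hom_poly k p" "clinear L"
  shows "hom_poly k (\<lambda>z. p (L z))"
proof -
  obtain K where K: "K > 0" "\<And>z. norm (L z) \<le> K * norm z"
    using bounded_linear.pos_bounded[OF clinear_bounded_linear[OF assms(2)]] by (metis mult.commute)
  obtain A where A: "\<And>z. norm (p z) \<le> A * norm z ^ k"
    using assms by (auto simp: hom_poly_def)
  have "norm (p (L z)) \<le> (\<bar>A\<bar> * K ^ k) * norm z ^ k" for z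
  proof -
    have "norm (p (L z)) \<le> \<bar>A\<bar> * norm (L z) ^ k"
      using A[of "L z"] by (rule order_trans) (simp add: mult_right_mono)
    also have "\<dots> \<le> \<bar>A\<bar> * (K * norm z) ^ k"
      by (intro mult_left_mono power_mono K(2)) auto
    finally show ?thesis by (simp add: power_mult_distrib mult_ac)
  qed
  then show ?thesis
    using assms(1) unfolding hom_poly_def by (auto simp: clinearD(1,3)[OF assms(2)])
qed

section \<open>Interpolation at roots of unity\<close>

definition node_kernel :: "nat \<Rightarrow> nat \<Rightarrow> complex \<Rightarrow> complex" where
  "node_kernel N j t = (\<Sum>a<N. (t / root_of_unity N j) ^ a) / of_nat N"

text \<open>Inverse discrete Fourier transform: orthogonality of the powers of the roots recovers
  each coefficient from the values at the nodes. Thus \<open>node_kernel N j\<close> is the Lagrange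
  basis polynomial of node \<open>j\<close>.\<close>

lemma polynomial_interpolation:
  fixes c :: "nat \<Rightarrow> complex" and N :: nat
  defines "g \<equiv> \<lambda>t. \<Sum>a<N. c a * t ^ a"
  shows "g t = (\<Sum>j<N. node_kernel N j t * g (root_of_unity N j))"
proof (cases "N = 0")
  case False
  let ?w = "root_of_unity N"
  have orth: "(\<Sum>j<N. ?w j ^ b / ?w j ^ a) = (if a = b then of_nat N else 0)"
    if "a < N" "b < N" for a b
  proof -
    have "?w j ^ b / ?w j ^ a = ?w j powi (int b - int a)" for j
      by (simp add: power_int_diff)
    then show ?thesis using sum_root_of_unity_powi[of "int b - int a" N] that by auto
  qed
  have "(\<Sum>j<N. node_kernel N j t * g (?w j))
      = (\<Sum>j<N. \<Sum>a<N. \<Sum>b<N. t ^ a * c b / of_nat N * (?w j ^ b / ?w j ^ a))"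
    by (simp add: node_kernel_def g_def sum_distrib_left sum_distrib_right sum_divide_distrib
        power_divide mult_ac)
  also have "\<dots> = (\<Sum>a<N. \<Sum>b<N. \<Sum>j<N. t ^ a * c b / of_nat N * (?w j ^ b / ?w j ^ a))"
    by (rule trans[OF sum.swap]) (intro sum.cong refl sum.swap)
  also have "\<dots> = (\<Sum>a<N. \<Sum>b<N. t ^ a * c b / of_nat N * (if a = b then of_nat N else 0))"
    by (intro sum.cong refl) (simp only: sum_distrib_left[symmetric] orth lessThan_iff)
  also have "\<dots> = g t"
    unfolding g_def using False
    by (intro sum.cong refl) (simp add: if_distrib sum.delta mult_ac cong: if_cong)
  finally show ?thesis by simp
qed (simp add: g_def)

text \<open>Along a line the norm bound becomes growth of order \<open>k\<close> in
  \<open>t\<close>, so Liouville's theorem for polynomial growth applies.\<close>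

lemma hom_poly_line_polynomial:
  assumes "hom_poly k q"
  shows "\<exists>c. \<forall>t. q (a + t *s b) = (\<Sum>i<Suc k. c i * t ^ i)"
proof -
  obtain A where A: "\<And>z. norm (q z) \<le> A * norm z ^ k"
    using assms by (auto simp: hom_poly_def)
  have hol: "(\<lambda>t. q (a + t *s b)) holomorphic_on UNIV"
    using assms by (auto simp: hom_poly_def)
  have bd: "norm (q (a + t *s b)) \<le> (\<bar>A\<bar> * (norm a + norm b) ^ k) * norm t ^ k" if "1 \<le> norm t" for t
  proof -
    have "norm (a + t *s b) \<le> (norm a + norm b) * norm t"
    proof -
      have "norm (a + t *s b) \<le> norm a + norm t * norm b"
        using norm_triangle_ineq[of a "t *s b"] by (simp add: norm_vector_smult)
      also have "norm a \<le> norm a * norm t"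
        using that by (simp add: mult_le_cancel_left1)
      finally show ?thesis by (simp add: algebra_simps)
    qed
    then have "\<bar>A\<bar> * norm (a + t *s b) ^ k \<le> \<bar>A\<bar> * ((norm a + norm b) * norm t) ^ k"
      by (intro mult_left_mono power_mono) auto
    moreover have "norm (q (a + t *s b)) \<le> \<bar>A\<bar> * norm (a + t *s b) ^ k"
      by (rule order_trans[OF A]) (simp add: mult_right_mono)
    ultimately show ?thesis by (simp add: power_mult_distrib mult_ac)
  qed
  have "q (a + t *s b) = (\<Sum>i\<le>k. (deriv ^^ i) (\<lambda>t. q (a + t *s b)) 0 / fact i * t ^ i)" for t
    using Liouville_polynomial[OF hol bd] .
  then show ?thesis unfolding lessThan_Suc_atMost
    by (intro exI[of _ "\<lambda>i. (deriv ^^ i) (\<lambda>t. q (a + t *s b)) 0 / fact i"] allI)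
qed

definition node :: "nat \<Rightarrow> ('n \<Rightarrow> nat) \<Rightarrow> complex^'n" where
  "node N x = (\<chi> i. root_of_unity N (x i))"

abbreviation node_indices :: "nat \<Rightarrow> ('n \<Rightarrow> nat) set" where
  "node_indices N \<equiv> PiE UNIV (\<lambda>_. {..<N})"

definition kernel :: "nat \<Rightarrow> ('n::finite \<Rightarrow> nat) \<Rightarrow> complex^'n \<Rightarrow> complex" where
  "kernel N x z = (\<Prod>i\<in>UNIV. node_kernel N (x i) (z $ i))"

text \<open>The one-variable formula is applied to one coordinate after another. The kernel does not
  depend on \<open>q\<close>, so finitely many values control a homogeneous polynomial; this stands
  in for finite dimensionality.\<close>

lemma hom_poly_interpolation:
  fixes q :: "complex^'n::finite \<Rightarrow> complex"
  assumes "hom_poly k q"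
  shows "q z = (\<Sum>x\<in>node_indices (Suc k). kernel (Suc k) x z * q (node (Suc k) x))"
proof -
  let ?N = "Suc k"
  \<comment> \<open>Coordinates in \<open>I\<close> are already moved to nodes, the others are still
    those of \<open>z\<close>.\<close>
  define mix where "mix I x = (\<chi> i. if i \<in> I then root_of_unity ?N (x i) else z $ i)" for I x
  have "q z = (\<Sum>x\<in>PiE I (\<lambda>_. {..<?N}).
      (\<Prod>i\<in>I. node_kernel ?N (x i) (z $ i)) * q (mix I x))" if "finite I" for I
    using that
  proof (induction I)
    case empty
    have "mix {} x = z" for x by (simp add: mix_def vec_eq_iff)
    then show ?case by simp
  next
    case (insert i I)
    have step: "q (mix I x) = (\<Sum>j<?N. node_kernel ?N j (z $ i) * q (mix (insert i I) (x(i := j))))" for x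
    proof -
      \<comment> \<open>On the line through \<open>a\<close> in direction \<open>i\<close>, the
        parameter \<open>z $ i\<close> gives \<open>mix I x\<close>, and a root of unity gives the
        next mixture.\<close>
      define a where "a = (\<chi> l. if l = i then 0 else mix I x $ l)"
      have line: "mix I x = a + z $ i *s axis i 1"
        using insert.hyps by (auto simp: a_def mix_def vec_eq_iff axis_def)
      have nodes: "mix (insert i I) (x(i := j)) = a + root_of_unity ?N j *s axis i 1" for j
        by (auto simp: a_def mix_def vec_eq_iff axis_def)
      obtain c where c: "\<And>t. q (a + t *s axis i 1) = (\<Sum>l<?N. c l * t ^ l)"
        using hom_poly_line_polynomial[OF assms] by blast
      show ?thesis unfolding line nodes c by (rule polynomial_interpolation)
    qed
    have "q z = (\<Sum>x\<in>PiE I (\<lambda>_. {..<?N}). \<Sum>j<?N. (\<Prod>i\<in>I. node_kernel ?N (x i) (z $ i)) *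
        (node_kernel ?N j (z $ i) * q (mix (insert i I) (x(i := j)))))"
      unfolding insert.IH by (intro sum.cong refl) (simp only: step sum_distrib_left)
    also have "\<dots> = (\<Sum>j<?N. \<Sum>x\<in>PiE I (\<lambda>_. {..<?N}). (\<Prod>i\<in>I. node_kernel ?N (x i) (z $ i)) *
        (node_kernel ?N j (z $ i) * q (mix (insert i I) (x(i := j)))))"
      by (rule sum.swap)
    also have "\<dots> = (\<Sum>(j, x)\<in>{..<?N} \<times> PiE I (\<lambda>_. {..<?N}). (\<Prod>i\<in>I. node_kernel ?N (x i) (z $ i)) *
        (node_kernel ?N j (z $ i) * q (mix (insert i I) (x(i := j)))))"
      by (simp add: sum.cartesian_product)
    also have "\<dots> = (\<Sum>x\<in>PiE (insert i I) (\<lambda>_. {..<?N}).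
        (\<Prod>i\<in>insert i I. node_kernel ?N (x i) (z $ i)) * q (mix (insert i I) x))"
    proof -
      \<comment> \<open>A choice of nodes on \<open>insert i I\<close> is a node for
        \<open>i\<close> together with a choice on \<open>I\<close>.\<close>
      have inj: "inj_on (\<lambda>(y, g). g(i := y)) ({..<?N} \<times> PiE I (\<lambda>_. {..<?N}))"
        by (rule inj_combinator) (use insert.hyps in auto)
      have pr: "(\<Prod>l\<in>insert i I. node_kernel ?N ((x(i := j)) l) (z $ l))
          = (\<Prod>l\<in>I. node_kernel ?N (x l) (z $ l)) * node_kernel ?N j (z $ i)" for x j
      proof -
        have "(\<Prod>l\<in>I. node_kernel ?N ((x(i := j)) l) (z $ l)) = (\<Prod>l\<in>I. node_kernel ?N (x l) (z $ l))"
          using insert.hyps by (intro prod.cong) auto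
        then show ?thesis using insert.hyps by (simp add: mult.commute)
      qed
      show ?thesis
        unfolding PiE_insert_eq sum.reindex[OF inj] comp_def split_beta pr
        by (simp only: mult.assoc)
    qed
    finally show ?case .
  qed
  from this[of UNIV] show ?thesis by (simp add: mix_def node_def kernel_def)
qed


text \<open>The definition speaks of lines only; joint continuity comes from the interpolation
  formula, whose kernels are polynomials in the coordinates.\<close>

lemma hom_poly_isCont:
  fixes q :: "complex^'n::finite \<Rightarrow> complex"
  assumes "hom_poly k q"
  shows "isCont q z"
proof -
  have "q = (\<lambda>z. \<Sum>x\<in>node_indices (Suc k). kernel (Suc k) x z * q (node (Suc k) x))"
    using hom_poly_interpolation[OF assms] by blast
  moreover have "continuous_on UNIV (\<lambda>z. \<Sum>x\<in>node_indices (Suc k). kernel (Suc k) x z * q (node (Suc k) x))"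
    unfolding kernel_def node_kernel_def by (intro continuous_intros) (auto simp del: of_nat_Suc)
  ultimately show ?thesis by (simp add: continuous_on_eq_continuous_at)
qed

text \<open>Nodes have modulus 1, so each factor of the kernel is at most a truncated geometric sum
  in the radius, whatever the node. The 1 added makes the bound positive.\<close>

lemma kernel_bound:
  obtains B where "0 < B"
    "\<And>x (z :: complex^'n::finite). norm z \<le> R \<Longrightarrow> norm (kernel N x z) \<le> B"
proof -
  define S where "S = (\<Sum>a<N. \<bar>R\<bar> ^ a)"
  have nk: "norm (node_kernel N j t) \<le> S" if "norm t \<le> R" for j t
  proof (cases "N = 0")
    case False
    have "norm (\<Sum>a<N. (t / root_of_unity N j) ^ a) \<le> S"
      unfolding S_def
      by (rule order_trans[OF norm_sum sum_mono]) (use that in \<open>auto simp: norm_power norm_divide intro!: power_mono\<close>)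
    moreover have "1 \<le> real N" "0 \<le> S" using False by (auto simp: S_def sum_nonneg)
    moreover have "S \<le> S * real N" using calculation by (simp add: mult_le_cancel_left1)
    ultimately show ?thesis using False
      by (simp add: node_kernel_def norm_divide divide_simps)
  qed (simp add: node_kernel_def S_def)
  have "norm (kernel N x z) \<le> S ^ CARD('n) + 1" if "norm z \<le> R" for x and z :: "complex^'n"
  proof -
    have "norm (kernel N x z) \<le> (\<Prod>i\<in>(UNIV::'n set). S)"
      unfolding kernel_def prod_norm[symmetric]
      by (intro prod_mono conjI nk norm_ge_zero order_trans[OF Finite_Cartesian_Product.norm_nth_le that])
    then show ?thesis by simp
  qed
  moreover have "0 \<le> S" by (simp add: S_def sum_nonneg)
  ultimately show ?thesis using that[of "S ^ CARD('n) + 1"] by (simp add: add_nonneg_pos)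
qed

text \<open>Multiplying out the kernels gives monomials with every exponent at most
  \<open>k\<close>. Averaging \<open>q (c *s z) / c ^ k\<close> over roots of unity \<open>c\<close>
  leaves \<open>q\<close> unchanged and removes all monomials of total degree other than
  \<open>k\<close>.\<close>

lemma hom_poly_monomials:
  fixes q :: "complex^'n::finite \<Rightarrow> complex"
  assumes "hom_poly k q"
  shows "\<exists>b. \<forall>z. q z = (\<Sum>\<alpha> | \<alpha> \<in> node_indices (Suc k) \<and> sum \<alpha> UNIV = k. b \<alpha> * (\<Prod>i\<in>UNIV. z $ i ^ \<alpha> i))"
proof -
  let ?N = "Suc k" and ?A = "node_indices (Suc k) :: ('n \<Rightarrow> nat) set"
  have fin: "finite ?A" by (intro finite_PiE) auto
  define c where "c x \<alpha> = (\<Prod>i\<in>UNIV. 1 / (root_of_unity ?N (x i) ^ \<alpha> i * of_nat ?N))" for x \<alpha> :: "'n \<Rightarrow> nat"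
  have kernel: "kernel ?N x z = (\<Sum>\<alpha>\<in>?A. c x \<alpha> * (\<Prod>i\<in>UNIV. z $ i ^ \<alpha> i))" for x z
  proof -
    have "kernel ?N x z = (\<Prod>i\<in>UNIV. \<Sum>a<?N. 1 / (root_of_unity ?N (x i) ^ a * of_nat ?N) * z $ i ^ a)"
      unfolding kernel_def node_kernel_def
      by (intro prod.cong refl)
        (simp add: sum_divide_distrib power_divide del: sum.lessThan_Suc of_nat_Suc)
    also have "\<dots> = (\<Sum>\<alpha>\<in>?A. \<Prod>i\<in>UNIV. 1 / (root_of_unity ?N (x i) ^ \<alpha> i * of_nat ?N) * z $ i ^ \<alpha> i)"
      by (rule prod_sum_PiE) auto
    finally show ?thesis unfolding c_def prod.distrib .
  qed
  define b where "b \<alpha> = (\<Sum>x\<in>?A. c x \<alpha> * q (node ?N x))" for \<alpha>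
  have q: "q z = (\<Sum>\<alpha>\<in>?A. b \<alpha> * (\<Prod>i\<in>UNIV. z $ i ^ \<alpha> i))" for z
  proof -
    have "q z = (\<Sum>x\<in>?A. \<Sum>\<alpha>\<in>?A. c x \<alpha> * q (node ?N x) * (\<Prod>i\<in>UNIV. z $ i ^ \<alpha> i))"
      by (subst hom_poly_interpolation[OF assms], unfold kernel) (simp add: sum_distrib_left mult_ac)
    also have "\<dots> = (\<Sum>\<alpha>\<in>?A. \<Sum>x\<in>?A. c x \<alpha> * q (node ?N x) * (\<Prod>i\<in>UNIV. z $ i ^ \<alpha> i))"
      by (rule sum.swap)
    finally show ?thesis by (simp only: b_def sum_distrib_right)
  qed
  \<comment> \<open>Larger than the distance from \<open>k\<close> to any total degree occurring in
    \<open>?A\<close>, so that no unwanted degree survives the average.\<close>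
  define M where "M = Suc (CARD('n) * k + k)"
  let ?w = "root_of_unity M"
  have orth: "(\<Sum>l<M. ?w l ^ sum \<alpha> UNIV / ?w l ^ k) = (if sum \<alpha> UNIV = k then of_nat M else 0)"
    if "\<alpha> \<in> ?A" for \<alpha>
  proof -
    have eq: "?w l ^ sum \<alpha> UNIV / ?w l ^ k = ?w l powi (int (sum \<alpha> UNIV) - int k)" for l
      by (simp add: power_int_diff del: of_nat_sum)
    have "\<alpha> i \<le> k" for i using that PiE_mem[of \<alpha> UNIV "\<lambda>_. {..<Suc k}" i] by simp
    then have "sum \<alpha> UNIV \<le> CARD('n) * k" using sum_bounded_above[of UNIV \<alpha> k] by simp
    then have "\<bar>int (sum \<alpha> UNIV) - int k\<bar> < int M" unfolding M_def by linarith
    moreover have "int (sum \<alpha> UNIV) - int k \<noteq> 0" if "sum \<alpha> UNIV \<noteq> k"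
      using that by (simp del: of_nat_sum)
    ultimately have "(\<Sum>l<M. ?w l powi (int (sum \<alpha> UNIV) - int k)) = 0" if "sum \<alpha> UNIV \<noteq> k"
      using that by (intro sum_root_of_unity_powi)
    then show ?thesis unfolding eq by (cases "sum \<alpha> UNIV = k") (simp_all del: of_nat_sum)
  qed
  have mon: "(\<Prod>i\<in>UNIV. (c *s z) $ i ^ \<alpha> i) = c ^ sum \<alpha> UNIV * (\<Prod>i\<in>UNIV. z $ i ^ \<alpha> i)"
    for c and z :: "complex^'n" and \<alpha>
    by (simp add: power_mult_distrib prod.distrib power_sum)
  have "of_nat M * q z = of_nat M *
      (\<Sum>\<alpha> | \<alpha> \<in> ?A \<and> sum \<alpha> UNIV = k. b \<alpha> * (\<Prod>i\<in>UNIV. z $ i ^ \<alpha> i))" for z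
  proof -
    have "?w l ^ k * q z = q (?w l *s z)" for l
      using assms by (simp add: hom_poly_def)
    then have "q z = q (?w l *s z) / ?w l ^ k" for l
      by (simp add: field_simps)
    then have "of_nat M * q z = (\<Sum>l<M. q (?w l *s z) / ?w l ^ k)"
      by simp
    also have "\<dots> = (\<Sum>l<M. \<Sum>\<alpha>\<in>?A. b \<alpha> * (\<Prod>i\<in>UNIV. z $ i ^ \<alpha> i) * (?w l ^ sum \<alpha> UNIV / ?w l ^ k))"
      unfolding q[of "_ *s z"] mon sum_divide_distrib by (intro sum.cong refl) simp
    also have "\<dots> = (\<Sum>\<alpha>\<in>?A. \<Sum>l<M. b \<alpha> * (\<Prod>i\<in>UNIV. z $ i ^ \<alpha> i) * (?w l ^ sum \<alpha> UNIV / ?w l ^ k))"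
      by (rule sum.swap)
    also have "\<dots> = (\<Sum>\<alpha>\<in>?A. b \<alpha> * (\<Prod>i\<in>UNIV. z $ i ^ \<alpha> i) * (if sum \<alpha> UNIV = k then of_nat M else 0))"
      unfolding sum_distrib_left[symmetric] by (intro sum.cong refl) (simp only: orth)
    also have "\<dots> = (\<Sum>\<alpha>\<in>?A. if sum \<alpha> UNIV = k then of_nat M * (b \<alpha> * (\<Prod>i\<in>UNIV. z $ i ^ \<alpha> i)) else 0)"
      by (intro sum.cong refl) (simp add: mult_ac)
    also have "\<dots> = (\<Sum>\<alpha> | \<alpha> \<in> ?A \<and> sum \<alpha> UNIV = k. of_nat M * (b \<alpha> * (\<Prod>i\<in>UNIV. z $ i ^ \<alpha> i)))"
      using fin by (simp add: sum.inter_filter)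
    finally show ?thesis by (simp add: sum_distrib_left)
  qed
  note eq = this
  have "(of_nat M :: complex) \<noteq> 0" unfolding of_nat_eq_0_iff by (simp add: M_def)
  from mult_left_cancel[OF this] eq show ?thesis by blast
qed

text \<open>Each monomial is multiplied by a root of unity to the power of its weighted degree minus
  \<open>d\<close>. This exponent is nonzero by \<open>nores\<close> and smaller than
  \<open>N\<close> in absolute value, so the sum vanishes. The finite sum replaces an integral over
  the circle.\<close>

lemma hom_poly_average_eq_zero:
  fixes q :: "complex^'n::finite \<Rightarrow> complex" and w :: "'n \<Rightarrow> nat"
  assumes "hom_poly k q"
    and nores: "\<And>\<alpha>. sum \<alpha> UNIV = k \<Longrightarrow> d \<noteq> (\<Sum>i\<in>UNIV. w i * \<alpha> i)"
    and N: "d + k * sum w UNIV < N"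
  shows "(\<Sum>l<N. q (\<chi> i. root_of_unity N l ^ w i * z $ i) / root_of_unity N l ^ d) = 0"
proof -
  let ?A = "{\<alpha> \<in> node_indices (Suc k). sum \<alpha> UNIV = k} :: ('n \<Rightarrow> nat) set"
  obtain b where b: "\<And>z. q z = (\<Sum>\<alpha>\<in>?A. b \<alpha> * (\<Prod>i\<in>UNIV. z $ i ^ \<alpha> i))"
    using hom_poly_monomials[OF assms(1)] by blast
  let ?w = "root_of_unity N"
  have orth: "(\<Sum>l<N. ?w l ^ (\<Sum>i\<in>UNIV. w i * \<alpha> i) / ?w l ^ d) = 0" if "\<alpha> \<in> ?A" for \<alpha>
  proof -
    have eq: "?w l ^ (\<Sum>i\<in>UNIV. w i * \<alpha> i) / ?w l ^ d = ?w l powi (int (\<Sum>i\<in>UNIV. w i * \<alpha> i) - int d)" for l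
      by (simp add: power_int_diff del: of_nat_sum)
    have "\<alpha> i \<le> k" for i using that PiE_mem[of \<alpha> UNIV "\<lambda>_. {..<Suc k}" i] by simp
    then have "(\<Sum>i\<in>UNIV. w i * \<alpha> i) \<le> k * sum w UNIV"
      unfolding sum_distrib_left by (intro sum_mono) (simp add: mult.commute mult_le_mono)
    then have "\<bar>int (\<Sum>i\<in>UNIV. w i * \<alpha> i) - int d\<bar> < int N" using N by linarith
    moreover have "int (\<Sum>i\<in>UNIV. w i * \<alpha> i) - int d \<noteq> 0" using nores[of \<alpha>] that by (auto simp del: of_nat_sum)
    ultimately show ?thesis unfolding eq by (rule sum_root_of_unity_powi)
  qed
  have mon: "(\<Prod>i\<in>UNIV. (\<chi> i. c ^ w i * z $ i) $ i ^ \<alpha> i) =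
      c ^ (\<Sum>i\<in>UNIV. w i * \<alpha> i) * (\<Prod>i\<in>UNIV. z $ i ^ \<alpha> i)" for c \<alpha>
    by (simp add: power_mult_distrib prod.distrib power_sum power_mult)
  have "(\<Sum>l<N. q (\<chi> i. ?w l ^ w i * z $ i) / ?w l ^ d) =
      (\<Sum>l<N. \<Sum>\<alpha>\<in>?A. b \<alpha> * (\<Prod>i\<in>UNIV. z $ i ^ \<alpha> i) * (?w l ^ (\<Sum>i\<in>UNIV. w i * \<alpha> i) / ?w l ^ d))"
    unfolding b mon sum_divide_distrib by (intro sum.cong refl) simp
  also have "\<dots> = (\<Sum>\<alpha>\<in>?A. \<Sum>l<N. b \<alpha> * (\<Prod>i\<in>UNIV. z $ i ^ \<alpha> i) * (?w l ^ (\<Sum>i\<in>UNIV. w i * \<alpha> i) / ?w l ^ d))"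
    by (rule sum.swap)
  also have "\<dots> = 0"
    unfolding sum_distrib_left[symmetric] using orth by (intro sum.neutral ballI) simp
  finally show ?thesis .
qed

section \<open>Homogeneous parts of a holomorphic function\<close>

text \<open>The homogeneous part of degree \<open>k\<close> at the origin, read off from the slice
  through \<open>z\<close> so as to avoid power series in several variables.\<close>

definition hpart :: "nat \<Rightarrow> (complex^'n \<Rightarrow> complex) \<Rightarrow> complex^'n \<Rightarrow> complex" where
  "hpart k h z = (deriv ^^ k) (\<lambda>t. h (t *s z)) 0 / fact k"

text \<open>Lines that miss the origin are included because the homogeneous parts have to be
  holomorphic on those too.\<close>

definition bounded_line_holomorphic :: "real \<Rightarrow> real \<Rightarrow> (complex^'n \<Rightarrow> complex) \<Rightarrow> bool" where
  "bounded_line_holomorphic r M h \<longleftrightarrow> 0 < r \<and> (\<forall>z. norm z < r \<longrightarrow> norm (h z) \<le> M) \<and>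
     (\<forall>a b. (\<lambda>t. h (a + t *s b)) holomorphic_on {t. norm (a + t *s b) < r})"

lemma continuous_on_line: "continuous_on A (\<lambda>t. a + t *s (b :: complex^'n))"
  unfolding vector_scalar_mult_def by (intro continuous_intros)

section \<open>Cauchy estimates and Taylor remainders on a ball\<close>

context
  fixes r M and h :: "complex^'n::finite \<Rightarrow> complex"
  assumes h: "bounded_line_holomorphic r M h"
begin

lemma radius_pos: "0 < r" and norm_le_bound: "norm z < r \<Longrightarrow> norm (h z) \<le> M"
  and bound_nonneg: "0 \<le> M"
  using h order_trans[OF norm_ge_zero[of "h 0"]] by (auto simp: bounded_line_holomorphic_def)

lemma holomorphic_ray: "(\<lambda>t. h (t *s z)) holomorphic_on {t. norm t * norm z < r}"
proof -
  have "(\<lambda>t. h (0 + t *s z)) holomorphic_on {t. norm (0 + t *s z) < r}"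
    using h unfolding bounded_line_holomorphic_def by blast
  then show ?thesis by (simp add: norm_vector_smult)
qed

lemma holomorphic_ray_ball:
  assumes "s * norm z \<le> r" shows "(\<lambda>t. h (t *s z)) holomorphic_on ball 0 s"
proof (rule holomorphic_on_subset[OF holomorphic_ray])
  show "ball 0 s \<subseteq> {t :: complex. norm t * norm z < r}"
  proof
    fix t :: complex assume "t \<in> ball 0 s"
    then have t: "norm t < s" by simp
    show "t \<in> {t. norm t * norm z < r}"
    proof (cases "z = 0")
      case False
      then have "norm t * norm z < s * norm z" using t by simp
      then show ?thesis using assms by simp
    qed (use radius_pos in simp)
  qed
qed

lemma norm_hpart_scaled:
  assumes "0 < s" "s * norm z < r"
  shows "norm (hpart j h z) \<le> M / s ^ j"
proof -
  have cball: "cball 0 s \<subseteq> {t :: complex. norm t * norm z < r}"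
  proof
    fix t :: complex assume "t \<in> cball 0 s"
    then have "norm t * norm z \<le> s * norm z" by (simp add: mult_right_mono)
    then show "t \<in> {t. norm t * norm z < r}" using assms by simp
  qed
  have "norm ((deriv ^^ j) (\<lambda>t. h (t *s z)) 0) \<le> fact j * M / s ^ j"
  proof (rule Cauchy_inequality)
    show "(\<lambda>t. h (t *s z)) holomorphic_on ball 0 s"
      using assms by (intro holomorphic_ray_ball) simp
    show "continuous_on (cball 0 s) (\<lambda>t. h (t *s z))"
      by (intro holomorphic_on_imp_continuous_on holomorphic_on_subset[OF holomorphic_ray cball])
    show "norm (h (t *s z)) \<le> M" if "norm (0 - t) = s" for t
      using that assms by (intro norm_le_bound) (simp add: norm_vector_smult)
  qed (use assms in simp)
  from divide_right_mono[OF this, of "fact j"] show ?thesis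
    by (simp add: hpart_def norm_divide)
qed

lemma norm_hpart: "norm (hpart j h z) \<le> M * (2 / r) ^ j * norm z ^ j"
proof (cases "z = 0")
  case False
  \<comment> \<open>Half of the largest radius, so the closed disc stays inside; hence the factor 2
    in the bound.\<close>
  define s where "s = r / (2 * norm z)"
  have "0 < s" "s * norm z < r" using False radius_pos by (auto simp: s_def)
  from norm_hpart_scaled[OF this, of j] show ?thesis
    by (simp add: s_def power_divide power_mult_distrib mult_ac)
next
  case True
  \<comment> \<open>At the origin the bound for \<open>j = 0\<close> reads \<open>M\<close>, as
    \<open>0 ^ 0 = 1\<close>; for \<open>j > 0\<close> the slice is constant.\<close>
  show ?thesis
  proof (cases j)
    case 0
    then show ?thesis using True norm_le_bound[of 0] radius_pos by (simp add: hpart_def)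
  next
    case (Suc i)
    have "(deriv ^^ Suc i) (\<lambda>t. c) 0 = 0" for c :: complex
      by (simp add: higher_deriv_const del: funpow.simps)
    then show ?thesis using True Suc by (simp add: hpart_def del: funpow.simps)
  qed
qed

lemma hpart_sums:
  assumes "norm z < r" shows "(\<lambda>j. hpart j h z) sums h z"
proof -
  \<comment> \<open>A disc that contains 1 and on which the slice is holomorphic; at the origin any
    radius above 1 serves.\<close>
  define s where "s = (if z = 0 then 2 else r / norm z)"
  have "(\<lambda>t. h (t *s z)) holomorphic_on ball 0 s"
    by (rule holomorphic_ray_ball) (use radius_pos in \<open>simp add: s_def\<close>)
  moreover have "1 \<in> ball (0::complex) s"
    using assms by (simp add: s_def)
  ultimately have "(\<lambda>j. (deriv ^^ j) (\<lambda>t. h (t *s z)) 0 / fact j * (1 - 0) ^ j) sums h (1 *s z)"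
    by (rule holomorphic_power_series)
  then show ?thesis by (simp add: hpart_def)
qed

lemma hpart_scale:
  shows "hpart k h (c *s z) = c ^ k * hpart k h z"
proof -
  let ?U = "{t. norm t * norm z < r}" and ?S = "{t. norm t * norm (c *s z) < r}"
  have op: "open ?U" "open ?S" by (auto intro!: open_Collect_less continuous_intros)
  have "(deriv ^^ k) (\<lambda>t. (\<lambda>t. h (t *s z)) (c * t)) 0 = c ^ k * (deriv ^^ k) (\<lambda>t. h (t *s z)) (c * 0)"
    by (rule higher_deriv_compose_linear[OF holomorphic_ray op(2,1)])
      (use radius_pos in \<open>auto simp: norm_vector_smult norm_mult mult_ac\<close>)
  moreover have "(\<lambda>t. h (t *s (c *s z))) = (\<lambda>t. h ((c * t) *s z))"
    by (simp add: mult.commute)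
  ultimately show ?thesis by (simp add: hpart_def)
qed

text \<open>The tail is dominated by a geometric series; \<open>norm z \<le> r / 4\<close> makes its
  ratio \<open>x\<close> at most 1/2, hence its sum at most twice the first term.\<close>

lemma taylor_remainder:
  assumes "norm z \<le> r / 4"
  shows "norm (h z - (\<Sum>j<k. hpart j h z)) \<le> 2 * M * (2 / r) ^ k * norm z ^ k"
proof -
  define x where "x = 2 / r * norm z"
  have x: "0 \<le> x" "x \<le> 1 / 2" using assms radius_pos by (auto simp: x_def field_simps)
  have "norm z < r" using assms radius_pos by simp
  note sums = hpart_sums[OF this]
  have bd: "norm (hpart (j + k) h z) \<le> M * x ^ k * x ^ j" for j
    using norm_hpart[of "j + k" z] by (simp add: x_def power_add power_mult_distrib power_divide mult_ac)
  have geo: "summable (\<lambda>j. M * x ^ k * x ^ j)"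
    using x by (intro summable_mult summable_geometric) auto
  have "h z - (\<Sum>j<k. hpart j h z) = (\<Sum>j. hpart (j + k) h z)"
    using suminf_minus_initial_segment[OF sums_summable[OF sums], of k] sums by (simp add: sums_iff)
  also have "norm \<dots> \<le> (\<Sum>j. M * x ^ k * x ^ j)"
    by (rule norm_suminf_le[OF bd geo])
  also have "\<dots> = M * x ^ k * (1 / (1 - x))"
    using x by (subst suminf_mult) (auto simp: suminf_geometric intro!: summable_geometric)
  also have "\<dots> \<le> M * x ^ k * 2"
    using x bound_nonneg by (intro mult_left_mono) (auto simp: field_simps)
  finally show ?thesis by (simp add: x_def power_mult_distrib power_divide mult_ac)
qed

text \<open>The degree \<open>k\<close> part is a locally uniform limit of rescaled Taylor remainders.\<close>

lemma hpart_line_holomorphic: "(\<lambda>t. hpart k h (a + t *s b)) holomorphic_on UNIV"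
proof (induction k arbitrary: a b rule: less_induct)
  case (less k)
  have "(\<lambda>t. hpart k h (a + t *s b)) holomorphic_on ball 0 R" if "R > 0" for R
  proof -
    define K where "K = norm a + R * norm b + 1"
    have "K > 0" using that by (simp add: K_def add_nonneg_pos)
    have K: "norm (a + t *s b) \<le> K" if "t \<in> ball 0 R" for t
    proof -
      have "norm (a + t *s b) \<le> norm a + norm t * norm b"
        using norm_triangle_ineq[of a "t *s b"] by (simp add: norm_vector_smult)
      also have "\<dots> \<le> K" using that mult_right_mono[of "norm t" R "norm b"] by (simp add: K_def)
      finally show ?thesis .
    qed
    \<comment> \<open>Scales tending to 0, small enough that \<open>taylor_remainder\<close> applies
      to all rescaled points.\<close>
    define \<epsilon> where "\<epsilon> n = complex_of_real (r / (4 * K * real (Suc n)))" for n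
    have e0: "\<epsilon> n \<noteq> 0" and en: "norm (\<epsilon> n) = r / (4 * K * real (Suc n))" for n
      using radius_pos \<open>K > 0\<close> unfolding \<epsilon>_def norm_of_real of_real_eq_0_iff by (auto simp del: of_nat_Suc)
    have small: "norm (\<epsilon> n *s (a + t *s b)) \<le> r / 4" if "t \<in> ball 0 R" for n t
    proof -
      have "norm (\<epsilon> n *s (a + t *s b)) \<le> norm (\<epsilon> n) * K"
        using K[OF that] by (simp only: norm_vector_smult mult_left_mono norm_ge_zero)
      also have "\<dots> = r / (4 * real (Suc n))" using \<open>K > 0\<close> by (simp add: en)
      also have "\<dots> \<le> r / 4" using radius_pos by (intro divide_left_mono) auto
      finally show ?thesis .
    qed
    \<comment> \<open>The lower parts are holomorphic on lines by induction. Subtracting them and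
      dividing by \<open>\<epsilon> n ^ k\<close> isolates degree \<open>k\<close> up to an error of
      order \<open>\<epsilon> n\<close>.\<close>
    define F where "F n t = (h (\<epsilon> n *s (a + t *s b)) - (\<Sum>j<k. hpart j h (\<epsilon> n *s (a + t *s b)))) / \<epsilon> n ^ k" for n t
    show ?thesis
    proof (rule holomorphic_uniform_sequence)
      show "F n holomorphic_on ball 0 R" for n
      proof -
        have line: "\<epsilon> n *s (a + t *s b) = \<epsilon> n *s a + t *s (\<epsilon> n *s b)" for t
          by (simp add: vec_eq_iff algebra_simps)
        have "(\<lambda>t. h (\<epsilon> n *s a + t *s (\<epsilon> n *s b))) holomorphic_on {t. norm (\<epsilon> n *s a + t *s (\<epsilon> n *s b)) < r}"
          using h unfolding bounded_line_holomorphic_def by blast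
        moreover have "ball 0 R \<subseteq> {t. norm (\<epsilon> n *s a + t *s (\<epsilon> n *s b)) < r}"
          using small[of _ n] radius_pos unfolding line by fastforce
        ultimately have "(\<lambda>t. h (\<epsilon> n *s a + t *s (\<epsilon> n *s b))) holomorphic_on ball 0 R"
          by (rule holomorphic_on_subset)
        moreover have "(\<lambda>t. hpart j h (\<epsilon> n *s a + t *s (\<epsilon> n *s b))) holomorphic_on ball 0 R" if "j < k" for j
          using less.IH[OF that] by (rule holomorphic_on_subset) simp
        ultimately show ?thesis
          unfolding F_def line using e0 by (intro holomorphic_intros) auto
      qed
      fix t assume t: "t \<in> ball (0::complex) R"
      then obtain d where d: "d > 0" "cball t d \<subseteq> ball 0 R"
        by (meson open_ball open_contains_cball)
      define C where "C = 2 * M * (2 / r) ^ Suc k * K ^ Suc k"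
      have dist: "dist (F n u) (hpart k h (a + u *s b)) \<le> C * norm (\<epsilon> n)" if "u \<in> ball 0 R" for n u
      proof -
        let ?v = "a + u *s b"
        have "F n u - hpart k h ?v = (h (\<epsilon> n *s ?v) - (\<Sum>j<Suc k. hpart j h (\<epsilon> n *s ?v))) / \<epsilon> n ^ k"
          unfolding F_def sum.lessThan_Suc hpart_scale[of k]
          using e0[of n] by (simp add: diff_divide_distrib add_divide_distrib)
        then have "dist (F n u) (hpart k h ?v) \<le> 2 * M * (2 / r) ^ Suc k * norm (\<epsilon> n *s ?v) ^ Suc k / norm (\<epsilon> n) ^ k"
          using taylor_remainder[OF small[OF that], of n "Suc k"]
          by (simp only: dist_norm norm_divide norm_power divide_right_mono zero_le_power norm_ge_zero)
        also have "\<dots> = 2 * M * (2 / r) ^ Suc k * norm ?v ^ Suc k * norm (\<epsilon> n)"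
          unfolding norm_vector_smult power_mult_distrib using e0[of n] by simp
        also have "\<dots> \<le> C * norm (\<epsilon> n)"
          unfolding C_def using K[OF that] radius_pos bound_nonneg
          by (intro mult_right_mono mult_left_mono power_mono mult_nonneg_nonneg zero_le_power) auto
        finally show ?thesis .
      qed
      have "(\<lambda>n. C * norm (\<epsilon> n)) \<longlonglongrightarrow> 0"
      proof -
        have "(\<lambda>n. C * (r / (4 * K)) * inverse (real (Suc n))) \<longlonglongrightarrow> C * (r / (4 * K)) * 0"
          by (intro tendsto_intros LIMSEQ_inverse_real_of_nat)
        then show ?thesis unfolding en by (simp add: field_simps del: of_nat_Suc)
      qed
      have "uniform_limit (cball t d) F (\<lambda>t. hpart k h (a + t *s b)) sequentially"
      proof (rule uniform_limitI)
        fix e :: real assume "e > 0"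
        have "\<forall>\<^sub>F n in sequentially. C * norm (\<epsilon> n) < e"
          using \<open>(\<lambda>n. C * norm (\<epsilon> n)) \<longlonglongrightarrow> 0\<close> \<open>e > 0\<close> by (rule order_tendstoD)
        then show "\<forall>\<^sub>F n in sequentially. \<forall>u\<in>cball t d. dist (F n u) (hpart k h (a + u *s b)) < e"
          by eventually_elim (use dist d(2) in \<open>meson order_le_less_trans subsetD\<close>)
      qed
      then show "\<exists>d>0. cball t d \<subseteq> ball 0 R \<and> uniform_limit (cball t d) F (\<lambda>t. hpart k h (a + t *s b)) sequentially"
        using d by blast
    qed simp
  qed
  \<comment> \<open>\<open>R\<close> was arbitrary, so every point lies in a disc where holomorphy
    is known.\<close>
  then have hol: "(\<lambda>t. hpart k h (a + t *s b)) holomorphic_on ball 0 (norm s + 1)" for s :: complex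
    by (simp add: add_nonneg_pos)
  have "(\<lambda>t. hpart k h (a + t *s b)) field_differentiable at t" for t
    by (rule holomorphic_on_imp_differentiable_at[OF hol[of t]]) auto
  then show ?case by (simp add: holomorphic_on_def field_differentiable_at_within)
qed

lemma hom_poly_hpart: "hom_poly k (hpart k h)"
  unfolding hom_poly_def
  using hpart_scale[of k] hpart_line_holomorphic[of k] norm_hpart[of k] by blast

text \<open>By the remainder estimate the quotient tends to the part of degree \<open>k\<close>, so
  a limit found by other means identifies that part.\<close>

lemma hpart_unique:
  assumes "\<And>j. j < k \<Longrightarrow> hpart j h z = p j"
    and "((\<lambda>t. (h (t *s z) - (\<Sum>j<k. t ^ j * p j)) / t ^ k) \<longlongrightarrow> l) (at 0)"
  shows "hpart k h z = l"
proof (rule tendsto_unique[OF _ _ assms(2)])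
  define C where "C = 2 * M * (2 / r) ^ Suc k * norm z ^ Suc k"
  let ?F = "\<lambda>t. (h (t *s z) - (\<Sum>j<k. t ^ j * p j)) / t ^ k"
  have "\<forall>\<^sub>F t in at 0. norm (t *s z) \<le> r / 4"
  proof -
    have "((\<lambda>t :: complex. norm t * norm z) \<longlongrightarrow> norm (0::complex) * norm z) (at 0)"
      by (rule tendsto_mult[OF tendsto_norm[OF tendsto_ident_at] tendsto_const])
    then have "\<forall>\<^sub>F t in at (0::complex). norm t * norm z < r / 4"
      using radius_pos by (intro order_tendstoD) auto
    then show ?thesis by eventually_elim (simp add: norm_vector_smult)
  qed
  moreover have "\<forall>\<^sub>F t in at 0. t \<noteq> (0::complex)"
    by (simp add: eventually_at_filter)
  ultimately have "\<forall>\<^sub>F t in at 0. dist (?F t) (hpart k h z) \<le> C * norm t"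
  proof eventually_elim
    case (elim t)
    then have t: "t \<noteq> 0" by blast
    have "?F t - hpart k h z = (h (t *s z) - (\<Sum>j<Suc k. hpart j h (t *s z))) / t ^ k"
      using t assms(1) by (simp add: hpart_scale diff_divide_distrib add_divide_distrib)
    then have "dist (?F t) (hpart k h z) \<le> 2 * M * (2 / r) ^ Suc k * norm (t *s z) ^ Suc k / norm t ^ k"
      using taylor_remainder[OF elim(1), of "Suc k"]
      by (simp only: dist_norm norm_divide norm_power divide_right_mono zero_le_power norm_ge_zero)
    also have "\<dots> = C * norm t"
      using t by (simp add: C_def norm_vector_smult power_mult_distrib)
    finally show ?case .
  qed
  then have "\<forall>\<^sub>F t in at 0. norm (dist (?F t) (hpart k h z)) \<le> C * norm t"
    by (simp only: real_norm_def abs_of_nonneg zero_le_dist)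
  moreover have "((\<lambda>t. C * norm t) \<longlongrightarrow> 0) (at (0::complex))"
    by (intro tendsto_eq_intros) auto
  ultimately have "((\<lambda>t. dist (?F t) (hpart k h z)) \<longlongrightarrow> 0) (at 0)"
    by (rule Lim_null_comparison)
  then show "(?F \<longlongrightarrow> hpart k h z) (at 0)"
    by (simp only: tendsto_dist_iff[symmetric])
qed simp

end

section \<open>Holomorphic maps\<close>

lemma clinear_isCont: "clinear L \<Longrightarrow> isCont L z"
  using clinear_bounded_linear linear_continuous_at by blast

lemma clinear_has_derivative: "clinear L \<Longrightarrow> (L has_derivative L) (at z)"
  by (intro bounded_linear_imp_has_derivative clinear_bounded_linear)

lemma clinear_holomorphic: "clinear L \<Longrightarrow> holomorphic_map_on L S"
  unfolding holomorphic_map_on_def using clinear_has_derivative by blast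

lemma clinear_component:
  assumes "clinear L"
  shows "L z $ i = (\<Sum>j\<in>UNIV. L (axis j 1) $ i * z $ j)"
proof -
  have "z = (\<Sum>j\<in>UNIV. z $ j *s axis j 1)"
    by (simp add: vec_eq_iff axis_def if_distrib cong: if_cong)
  then have "L z = (\<Sum>j\<in>UNIV. z $ j *s L (axis j 1))"
    by (metis (no_types, lifting) clinearD(3,5)[OF assms] sum.cong)
  then show ?thesis by (simp add: mult.commute)
qed

lemma hom_poly_clinear_comp:
  assumes "clinear L" "\<And>i. hom_poly k (\<lambda>z. P z $ i)"
  shows "hom_poly k (\<lambda>z. L (P z) $ i)"
  by (subst clinear_component[OF assms(1)]) (intro hom_poly_sum hom_poly_cmult assms(2))

lemma norm_vec_le:
  fixes x :: "complex^'n"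
  assumes "\<And>i. norm (x $ i) \<le> C"
  shows "norm x \<le> real CARD('n) * C"
proof -
  have "norm x \<le> (\<Sum>i\<in>UNIV. norm (x $ i))"
    unfolding norm_vec_def by (rule L2_set_le_sum) simp
  also have "\<dots> \<le> real CARD('n) * C"
    using sum_bounded_above[of UNIV "\<lambda>i. norm (x $ i)" C] assms by simp
  finally show ?thesis .
qed

section \<open>Holomorphic maps on complex lines and under composition\<close>

lemma has_derivative_line: "((\<lambda>t. a + t *s b) has_derivative (\<lambda>s. s *s (b :: complex^'n))) (at t)"
proof -
  have "bounded_linear (\<lambda>s. s *s b)"
    by (intro linear_conv_bounded_linear[THEN iffD1] linearI)
      (simp_all add: vec_eq_iff algebra_simps)
  from has_derivative_add[OF has_derivative_const bounded_linear_imp_has_derivative[OF this]]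
  show ?thesis by simp
qed

lemma has_field_derivative_line:
  assumes "(f has_derivative A) (at (a + t *s b))" "clinear A"
  shows "((\<lambda>t. f (a + t *s b) $ i) has_field_derivative A b $ i) (at t)"
proof -
  have "((f \<circ> (\<lambda>t. a + t *s b)) has_derivative (A \<circ> (\<lambda>s. s *s b))) (at t)"
    using has_derivative_line assms(1) by (rule diff_chain_at)
  then have "((\<lambda>t. (f \<circ> (\<lambda>t. a + t *s b)) t $ i) has_derivative (\<lambda>s. (A \<circ> (\<lambda>s. s *s b)) s $ i)) (at t)"
    by (rule bounded_linear.has_derivative[OF bounded_linear_vec_nth])
  moreover have "(\<lambda>s. (A \<circ> (\<lambda>s. s *s b)) s $ i) = (*) (A b $ i)"
    using clinearD(3)[OF assms(2)] by (auto simp: fun_eq_iff mult.commute)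
  ultimately show ?thesis by (simp add: has_field_derivative_def comp_def)
qed

lemma holomorphic_map_on_line:
  assumes "holomorphic_map_on f S"
  shows "(\<lambda>t. f (a + t *s b) $ i) holomorphic_on {t. a + t *s b \<in> S}"
  unfolding holomorphic_on_def field_differentiable_def
proof
  fix t assume "t \<in> {t. a + t *s b \<in> S}"
  then obtain A where "clinear A" "(f has_derivative A) (at (a + t *s b))"
    using assms by (auto simp: holomorphic_map_on_def)
  then show "\<exists>f'. ((\<lambda>t. f (a + t *s b) $ i) has_field_derivative f') (at t within {t. a + t *s b \<in> S})"
    using has_field_derivative_line DERIV_subset by blast
qed

lemma holomorphic_map_on_compose:
  assumes "holomorphic_map_on f S" "holomorphic_map_on g T" "f ` S \<subseteq> T"
  shows "holomorphic_map_on (\<lambda>z. g (f z)) S"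
  unfolding holomorphic_map_on_def
proof
  fix z assume z: "z \<in> S"
  then obtain A where A: "clinear A" "(f has_derivative A) (at z)"
    using assms by (auto simp: holomorphic_map_on_def)
  have "f z \<in> T" using assms(3) z by blast
  then obtain B where B: "clinear B" "(g has_derivative B) (at (f z))"
    using assms(2) by (auto simp: holomorphic_map_on_def)
  show "\<exists>A. clinear A \<and> ((\<lambda>z. g (f z)) has_derivative A) (at z)"
    using clinear_compose[OF A(1) B(1)] diff_chain_at[OF A(2) B(2), unfolded comp_def] by blast
qed

text \<open>What the local arguments use: components bounded and holomorphic on lines, the origin
  fixed, and a complex derivative at 0, which makes the part of degree 1 linear.\<close>

definition germ :: "real \<Rightarrow> real \<Rightarrow> (complex^'n \<Rightarrow> complex^'k) \<Rightarrow> bool" where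
  "germ r M f \<longleftrightarrow> (\<forall>i. bounded_line_holomorphic r M (\<lambda>z. f z $ i)) \<and> f 0 = 0 \<and>
     (\<exists>A. clinear A \<and> (f has_derivative A) (at 0))"

definition hpart_vec :: "nat \<Rightarrow> (complex^'n \<Rightarrow> complex^'k) \<Rightarrow> complex^'n \<Rightarrow> complex^'k" where
  "hpart_vec k f z = (\<chi> i. hpart k (\<lambda>z. f z $ i) z)"

lemma holomorphic_map_on_germ:
  assumes "holomorphic_map_on f S" "ball 0 r \<subseteq> S" "0 < r" "f 0 = 0"
    and "\<And>z. z \<in> S \<Longrightarrow> norm (f z) \<le> M"
  shows "germ r M f"
  unfolding germ_def bounded_line_holomorphic_def
proof (intro conjI allI impI)
  show "norm (f z $ i) \<le> M" if "norm z < r" for z i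
    using that assms(2,5) by (intro order_trans[OF Finite_Cartesian_Product.norm_nth_le]) auto
  show "(\<lambda>t. f (a + t *s b) $ i) holomorphic_on {t. norm (a + t *s b) < r}" for a b i
    by (rule holomorphic_on_subset[OF holomorphic_map_on_line[OF assms(1)]]) (use assms(2) in auto)
  have "0 \<in> S" using assms(2,3) by auto
  then show "\<exists>A. clinear A \<and> (f has_derivative A) (at 0)"
    using assms(1) by (auto simp: holomorphic_map_on_def)
qed (use assms in auto)

lemma hpart_vec_eq_derivative:
  assumes "(f has_derivative A) (at 0)" "clinear A"
  shows "hpart_vec 1 f = A"
proof -
  have "((\<lambda>t. f (0 + t *s z) $ i) has_field_derivative A z $ i) (at 0)" for z i
    by (rule has_field_derivative_line) (use assms in simp_all)
  then have "deriv (\<lambda>t. f (t *s z) $ i) 0 = A z $ i" for z i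
    by (simp add: DERIV_imp_deriv)
  then show ?thesis by (simp add: hpart_vec_def hpart_def fun_eq_iff vec_eq_iff)
qed

lemma hpart_vec_1_germ:
  assumes "germ r M f"
  shows "clinear (hpart_vec 1 f)" "(f has_derivative hpart_vec 1 f) (at 0)"
proof -
  obtain A where A: "clinear A" "(f has_derivative A) (at 0)"
    using assms by (auto simp: germ_def)
  then have "hpart_vec 1 f = A" by (intro hpart_vec_eq_derivative)
  with A show "clinear (hpart_vec 1 f)" "(f has_derivative hpart_vec 1 f) (at 0)" by simp_all
qed

lemma hpart_vec_1_compose:
  assumes "germ r M f" "germ s N g"
  shows "hpart_vec 1 (\<lambda>z. g (f z)) = (\<lambda>z. hpart_vec 1 g (hpart_vec 1 f z))"
proof (rule hpart_vec_eq_derivative)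
  have "f 0 = 0" using assms by (simp add: germ_def)
  then show "((\<lambda>z. g (f z)) has_derivative (\<lambda>z. hpart_vec 1 g (hpart_vec 1 f z))) (at 0)"
    using diff_chain_at[OF hpart_vec_1_germ(2)[OF assms(1)], of g "hpart_vec 1 g"] hpart_vec_1_germ(2)[OF assms(2)]
    by (simp add: comp_def)
  show "clinear (\<lambda>z. hpart_vec 1 g (hpart_vec 1 f z))"
    by (rule clinear_compose[OF hpart_vec_1_germ(1) hpart_vec_1_germ(1), OF assms])
qed

lemma hpart_vec_0_germ: "germ r M f \<Longrightarrow> hpart_vec 0 f z = 0"
  by (simp add: germ_def hpart_vec_def hpart_def vec_eq_iff)

lemma hom_poly_hpart_vec: "germ r M f \<Longrightarrow> hom_poly k (\<lambda>z. hpart_vec k f z $ i)"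
  using hom_poly_hpart[of r M "\<lambda>z. f z $ i" k] by (simp add: germ_def hpart_vec_def)

lemma norm_hpart_vec:
  fixes f :: "complex^'n \<Rightarrow> complex^'k"
  assumes "germ r M f"
  shows "norm (hpart_vec k f z) \<le> real CARD('k) * M * (2 / r) ^ k * norm z ^ k"
proof -
  have "norm (hpart_vec k f z $ i) \<le> M * (2 / r) ^ k * norm z ^ k" for i
    using assms norm_hpart[of r M "\<lambda>z. f z $ i" k z] by (simp add: germ_def hpart_vec_def)
  from norm_vec_le[OF this] show ?thesis by (simp only: mult.assoc)
qed

lemma hpart_vec_isCont:
  assumes "germ r M f"
  shows "isCont (hpart_vec k f) z"
  unfolding isCont_def
  by (rule vec_tendstoI) (rule hom_poly_isCont[OF hom_poly_hpart_vec[OF assms], unfolded isCont_def])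

lemma hpart_vec_cong:
  assumes "\<And>z. norm z < s \<Longrightarrow> f z = g z" "0 < s"
  shows "hpart_vec k f = hpart_vec k g"
proof -
  have "(deriv ^^ k) (\<lambda>t. f (t *s z) $ i) 0 = (deriv ^^ k) (\<lambda>t. g (t *s z) $ i) 0" for z i
  proof (rule higher_deriv_cong_ev)
    have "open {t :: complex. norm t * norm z < s}"
      by (intro open_Collect_less continuous_intros)
    moreover have "0 \<in> {t :: complex. norm t * norm z < s}" using assms by simp
    ultimately have "\<forall>\<^sub>F t in nhds 0. t \<in> {t :: complex. norm t * norm z < s}"
      by (rule eventually_nhds_in_open)
    then show "\<forall>\<^sub>F t in nhds 0. f (t *s z) $ i = g (t *s z) $ i"
      by eventually_elim (simp add: assms(1) norm_vector_smult)
  qed simp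
  then show ?thesis by (simp add: hpart_vec_def hpart_def fun_eq_iff vec_eq_iff)
qed

lemma hpart_vec_clinear:
  assumes "clinear L" "2 \<le> k"
  shows "hpart_vec k L z = 0"
proof -
  have "(\<lambda>t. L (t *s z) $ i) = (\<lambda>t. L z $ i * t)" for i
    using assms by (simp add: clinearD(3) mult.commute)
  then show ?thesis using assms(2) by (simp add: hpart_vec_def hpart_def vec_eq_iff)
qed

lemma hpart_vec_1_clinear: "clinear L \<Longrightarrow> hpart_vec 1 L = L"
  by (rule hpart_vec_eq_derivative[OF clinear_has_derivative])

lemma hpart_vec_sums:
  assumes "germ r M f" "norm z < r"
  shows "(\<lambda>k. hpart_vec k f z $ i) sums (f z $ i)"
  using assms hpart_sums[of r M "\<lambda>z. f z $ i" z] by (simp add: germ_def hpart_vec_def)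

lemma germ_eq_linear:
  assumes "germ r M f" "\<And>k. 2 \<le> k \<Longrightarrow> hpart_vec k f z = 0" "norm z < r"
  shows "f z = hpart_vec 1 f z"
proof -
  have "(\<lambda>k. hpart_vec k f z $ i) sums (hpart_vec 1 f z $ i)" for i
  proof -
    have "hpart_vec k f z $ i = 0" if "k \<noteq> 1" for k
      using that assms(2)[of k] hpart_vec_0_germ[OF assms(1)] by (cases k) auto
    then have "(\<lambda>k. hpart_vec k f z $ i) = (\<lambda>k. if k = 1 then hpart_vec 1 f z $ i else 0)" by auto
    then show ?thesis using sums_single[of 1 "\<lambda>_. hpart_vec 1 f z $ i"] by simp
  qed
  from sums_unique2[OF hpart_vec_sums[OF assms(1,3)] this] show ?thesis
    unfolding vec_eq_iff by blast
qed

section \<open>The lowest nonlinear degree: remainders and composition\<close>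

lemma sum_eq_term_1:
  fixes p :: "nat \<Rightarrow> 'a::comm_monoid_add"
  assumes "2 \<le> k" "p 0 = 0" "\<And>j. 2 \<le> j \<Longrightarrow> j < k \<Longrightarrow> p j = 0"
  shows "(\<Sum>j<k. p j) = p 1"
proof -
  have "p j = 0" if "j < k" "j \<noteq> 1" for j
    using that assms(2,3) by (cases "j = 0") auto
  then have "(\<Sum>j<k. p j) = (\<Sum>j\<in>{1}. p j)"
    using assms(1) by (intro sum.mono_neutral_right) auto
  then show ?thesis by simp
qed

lemma germ_remainder:
  fixes f :: "complex^'n \<Rightarrow> complex^'k"
  assumes "germ r M f" "2 \<le> k" "\<And>j z. 2 \<le> j \<Longrightarrow> j < k \<Longrightarrow> hpart_vec j f z = 0"
  obtains C where "\<And>z. norm z \<le> r / 4 \<Longrightarrow> norm (f z - hpart_vec 1 f z - hpart_vec k f z) \<le> C * norm z ^ Suc k"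
proof
  let ?C = "2 * M * (2 / r) ^ Suc k"
  fix z :: "complex^'n" assume z: "norm z \<le> r / 4"
  have "norm ((f z - hpart_vec 1 f z - hpart_vec k f z) $ i) \<le> ?C * norm z ^ Suc k" for i
  proof -
    have "(\<Sum>j<k. hpart_vec j f z $ i) = hpart_vec 1 f z $ i"
      by (rule sum_eq_term_1) (use assms hpart_vec_0_germ[OF assms(1)] in auto)
    then have "(f z - hpart_vec 1 f z - hpart_vec k f z) $ i = f z $ i - (\<Sum>j<Suc k. hpart_vec j f z $ i)"
      by simp
    then show ?thesis
      using taylor_remainder[of r M "\<lambda>z. f z $ i" z "Suc k"] assms(1) z
      by (simp only: germ_def hpart_vec_def vec_lambda_beta)
  qed
  from norm_vec_le[OF this] show "norm (f z - hpart_vec 1 f z - hpart_vec k f z) \<le> (real CARD('k) * ?C) * norm z ^ Suc k"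
    by (simp only: mult.assoc)
qed

lemma hpart_vec_unique:
  fixes f :: "complex^'n \<Rightarrow> complex^'k"
  assumes "germ r M f" "2 \<le> k" "\<And>j z. 2 \<le> j \<Longrightarrow> j < k \<Longrightarrow> hpart_vec j f z = 0"
    and "((\<lambda>t. (1 / t ^ k) *s (f (t *s z) - t *s hpart_vec 1 f z)) \<longlongrightarrow> l) (at 0)"
  shows "hpart_vec k f z = l"
proof -
  have "hpart k (\<lambda>z. f z $ i) z = l $ i" for i
  proof (rule hpart_unique[where p = "\<lambda>j. hpart_vec j f z $ i"])
    show "bounded_line_holomorphic r M (\<lambda>z. f z $ i)" using assms by (simp add: germ_def)
    have "(\<Sum>j<k. t ^ j * hpart_vec j f z $ i) = t ^ 1 * hpart_vec 1 f z $ i" for t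
      by (rule sum_eq_term_1) (use assms hpart_vec_0_germ[OF assms(1)] in auto)
    then show "((\<lambda>t. (f (t *s z) $ i - (\<Sum>j<k. t ^ j * hpart_vec j f z $ i)) / t ^ k) \<longlongrightarrow> l $ i) (at 0)"
      using tendsto_vec_nth[OF assms(4), of i]
      by (simp add: diff_divide_distrib del: One_nat_def)
  qed (simp add: hpart_vec_def)
  then show ?thesis by (simp add: hpart_vec_def vec_eq_iff)
qed

lemma eventually_small:
  fixes u :: "complex \<Rightarrow> complex^'n"
  assumes "(u \<longlongrightarrow> l) (at 0)" "0 < s"
  shows "\<forall>\<^sub>F t in at 0. norm (t *s u t) \<le> s"
proof -
  have "((\<lambda>t. norm t * norm (u t)) \<longlongrightarrow> norm (0::complex) * norm l) (at 0)"
    by (rule tendsto_mult[OF tendsto_norm[OF tendsto_ident_at] tendsto_norm[OF assms(1)]])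
  then have "\<forall>\<^sub>F t in at 0. norm t * norm (u t) < s"
    using assms(2) by (intro order_tendstoD) auto
  then show ?thesis by eventually_elim (simp add: norm_vector_smult)
qed

text \<open>In a composition the inner map supplies arguments \<open>t *s u t\<close> whose
  direction \<open>u t\<close> merely converges, so the expansion is needed along moving directions.
  The error is of order \<open>norm t\<close>, and the part of degree \<open>k\<close> is
  continuous.\<close>

lemma germ_remainder_tendsto:
  fixes f :: "complex^'n \<Rightarrow> complex^'k" and u :: "complex \<Rightarrow> complex^'n"
  assumes "germ r M f" "2 \<le> k" "\<And>j z. 2 \<le> j \<Longrightarrow> j < k \<Longrightarrow> hpart_vec j f z = 0"
    and "(u \<longlongrightarrow> l) (at 0)"
  shows "((\<lambda>t. (1 / t ^ k) *s (f (t *s u t) - t *s hpart_vec 1 f (u t))) \<longlongrightarrow> hpart_vec k f l) (at 0)"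
proof -
  obtain C where C: "\<And>z. norm z \<le> r / 4 \<Longrightarrow> norm (f z - hpart_vec 1 f z - hpart_vec k f z) \<le> C * norm z ^ Suc k"
    using germ_remainder[OF assms(1-3)] by blast
  let ?F = "\<lambda>t. (1 / t ^ k) *s (f (t *s u t) - t *s hpart_vec 1 f (u t))"
  have r: "0 < r" using assms(1) by (simp add: germ_def bounded_line_holomorphic_def)
  have "\<forall>\<^sub>F t in at 0. norm (t *s u t) \<le> r / 4"
    using assms(4) by (rule eventually_small) (use r in simp)
  moreover have "\<forall>\<^sub>F t in at 0. t \<noteq> (0::complex)"
    by (simp add: eventually_at_filter)
  ultimately have "\<forall>\<^sub>F t in at 0. norm (?F t - hpart_vec k f (u t)) \<le> norm t * (C * norm (u t) ^ Suc k)"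
  proof eventually_elim
    case (elim t)
    have "hpart_vec k f (t *s u t) = t ^ k *s hpart_vec k f (u t)"
      using hom_poly_hpart_vec[OF assms(1), of k] by (simp add: hom_poly_def vec_eq_iff)
    then have "?F t - hpart_vec k f (u t) = (1 / t ^ k) *s (f (t *s u t) - hpart_vec 1 f (t *s u t) - hpart_vec k f (t *s u t))"
      using elim by (simp add: clinearD(3)[OF hpart_vec_1_germ(1)[OF assms(1)]] vec_eq_iff field_simps del: One_nat_def)
    then have "norm (?F t - hpart_vec k f (u t)) = norm (f (t *s u t) - hpart_vec 1 f (t *s u t) - hpart_vec k f (t *s u t)) / norm t ^ k"
      by (simp only: norm_vector_smult) (simp add: norm_divide norm_power)
    also have "\<dots> \<le> C * norm (t *s u t) ^ Suc k / norm t ^ k"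
      using C[OF elim(1)] by (rule divide_right_mono) simp
    also have "\<dots> = norm t * (C * norm (u t) ^ Suc k)"
      unfolding norm_vector_smult power_mult_distrib using elim by simp
    finally show ?case .
  qed
  moreover have "((\<lambda>t. norm t * (C * norm (u t) ^ Suc k)) \<longlongrightarrow> norm (0::complex) * (C * norm l ^ Suc k)) (at 0)"
    using assms(4) by (intro tendsto_mult tendsto_norm tendsto_ident_at tendsto_const tendsto_power)
  then have "((\<lambda>t. norm t * (C * norm (u t) ^ Suc k)) \<longlongrightarrow> 0) (at 0)"
    by (simp only: norm_zero mult_zero_left)
  ultimately have "((\<lambda>t. ?F t - hpart_vec k f (u t)) \<longlongrightarrow> 0) (at 0)"
    by (rule Lim_null_comparison)
  moreover have "((\<lambda>t. hpart_vec k f (u t)) \<longlongrightarrow> hpart_vec k f l) (at 0)"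
    using hpart_vec_isCont[OF assms(1)] assms(4) by (rule isCont_tendsto_compose)
  ultimately have "((\<lambda>t. (?F t - hpart_vec k f (u t)) + hpart_vec k f (u t)) \<longlongrightarrow> 0 + hpart_vec k f l) (at 0)"
    by (rule tendsto_add)
  then show ?thesis by simp
qed

text \<open>If \<open>f = A + P + ...\<close> and \<open>g = B + Q + ...\<close> with
  \<open>P\<close>, \<open>Q\<close> of degree \<open>k\<close> and nothing between degrees 1 and
  \<open>k\<close>, the composite is \<open>B A + (B P + Q A) + ...\<close>; all other terms have
  higher degree.\<close>

lemma hpart_vec_compose:
  fixes f :: "complex^'n \<Rightarrow> complex^'k" and g :: "complex^'k \<Rightarrow> complex^'l"
  assumes f: "germ r M f" and g: "germ r' M' g" and gf: "germ r'' M'' (\<lambda>z. g (f z))" and k: "2 \<le> k"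
    and f0: "\<And>j z. 2 \<le> j \<Longrightarrow> j < k \<Longrightarrow> hpart_vec j f z = 0"
    and g0: "\<And>j z. 2 \<le> j \<Longrightarrow> j < k \<Longrightarrow> hpart_vec j g z = 0"
    and gf0: "\<And>j z. 2 \<le> j \<Longrightarrow> j < k \<Longrightarrow> hpart_vec j (\<lambda>z. g (f z)) z = 0"
  shows "hpart_vec k (\<lambda>z. g (f z)) z = hpart_vec 1 g (hpart_vec k f z) + hpart_vec k g (hpart_vec 1 f z)"
proof (rule hpart_vec_unique[OF gf k gf0])
  \<comment> \<open>\<open>v\<close> is the rescaled nonlinear remainder of \<open>f\<close>, and
    \<open>u\<close> is chosen so that \<open>f (t *s z) = t *s u t\<close> for
    \<open>t \<noteq> 0\<close>; as \<open>k \<ge> 2\<close>, \<open>u\<close> tends to the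
    derivative applied to \<open>z\<close>.\<close>
  define v where "v t = (1 / t ^ k) *s (f (t *s z) - t *s hpart_vec 1 f z)" for t
  define u where "u t = hpart_vec 1 f z + t ^ (k - 1) *s v t" for t
  have v: "(v \<longlongrightarrow> hpart_vec k f z) (at 0)"
    unfolding v_def by (rule germ_remainder_tendsto[OF f k f0 tendsto_const])
  have smult: "((\<lambda>t. t ^ (k - 1) *s v t) \<longlongrightarrow> 0 ^ (k - 1) *s hpart_vec k f z) (at 0)"
    by (rule vec_tendstoI) (use tendsto_vec_nth[OF v] in \<open>auto intro!: tendsto_mult tendsto_power\<close>)
  have u: "(u \<longlongrightarrow> hpart_vec 1 f z) (at 0)"
    unfolding u_def using tendsto_add[OF tendsto_const smult, of "hpart_vec 1 f z"] k by (simp add: zero_power)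
  note lin = hpart_vec_1_germ(1)[OF g]
  have "((\<lambda>t. hpart_vec 1 g (v t)) \<longlongrightarrow> hpart_vec 1 g (hpart_vec k f z)) (at 0)"
    using clinear_isCont[OF lin] v by (rule isCont_tendsto_compose)
  then have lim: "((\<lambda>t. hpart_vec 1 g (v t) + (1 / t ^ k) *s (g (t *s u t) - t *s hpart_vec 1 g (u t)))
      \<longlongrightarrow> hpart_vec 1 g (hpart_vec k f z) + hpart_vec k g (hpart_vec 1 f z)) (at 0)"
    by (intro tendsto_add germ_remainder_tendsto[OF g k g0 u])
  have "\<forall>\<^sub>F t in at 0. t \<noteq> (0::complex)"
    by (simp add: eventually_at_filter)
  then have "\<forall>\<^sub>F t in at 0. hpart_vec 1 g (v t) + (1 / t ^ k) *s (g (t *s u t) - t *s hpart_vec 1 g (u t))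
      = (1 / t ^ k) *s (g (f (t *s z)) - t *s hpart_vec 1 (\<lambda>z. g (f z)) z)"
  proof eventually_elim
    case (elim t)
    have tk: "t * t ^ (k - 1) = t ^ k" using k by (cases k) auto
    have "t *s u t = t *s hpart_vec 1 f z + (t * t ^ (k - 1)) *s v t"
      by (simp add: u_def vec_eq_iff algebra_simps)
    also have "\<dots> = f (t *s z)"
      unfolding tk v_def using elim by (simp add: vec_eq_iff)
    finally have fu: "f (t *s z) = t *s u t" by simp
    have "t *s hpart_vec 1 g (u t) = t *s hpart_vec 1 g (hpart_vec 1 f z) + (t * t ^ (k - 1)) *s hpart_vec 1 g (v t)"
      by (simp add: u_def clinearD[OF lin] vec_eq_iff algebra_simps del: One_nat_def)
    then show ?case
      unfolding fu hpart_vec_1_compose[OF f g] tk using elim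
      by (simp add: vec_eq_iff field_simps del: One_nat_def)
  qed
  then show "((\<lambda>t. (1 / t ^ k) *s (g (f (t *s z)) - t *s hpart_vec 1 (\<lambda>z. g (f z)) z))
      \<longlongrightarrow> hpart_vec 1 g (hpart_vec k f z) + hpart_vec k g (hpart_vec 1 f z)) (at 0)"
    using lim by (rule Lim_transform_eventually[rotated])
qed

lemma hpart_vec_clinear_comp:
  fixes f :: "complex^'n \<Rightarrow> complex^'k" and L :: "complex^'k \<Rightarrow> complex^'l"
  assumes "germ r M f" "clinear L"
  shows "hpart_vec k (\<lambda>z. L (f z)) z = L (hpart_vec k f z)"
proof -
  have "hpart_vec k (\<lambda>z. L (f z)) z $ i = L (hpart_vec k f z) $ i" for i
  proof -
    have line: "\<And>j. bounded_line_holomorphic r M (\<lambda>z. f z $ j)" and r: "0 < r"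
      using assms(1) by (auto simp: germ_def bounded_line_holomorphic_def)
    let ?U = "{t :: complex. norm t * norm z < r}"
    have U: "open ?U" "0 \<in> ?U" using r by (auto intro!: open_Collect_less continuous_intros)
    note hol = holomorphic_ray[OF line, of z]
    have "(deriv ^^ k) (\<lambda>t. \<Sum>j\<in>J. c j * f (t *s z) $ j) 0 = (\<Sum>j\<in>J. c j * (deriv ^^ k) (\<lambda>t. f (t *s z) $ j) 0)"
      if "finite J" for J and c :: "'k \<Rightarrow> complex"
      using that
    proof (induction J)
      case (insert j J)
      have "(deriv ^^ k) (\<lambda>t. c j * f (t *s z) $ j + (\<Sum>j\<in>J. c j * f (t *s z) $ j)) 0
          = (deriv ^^ k) (\<lambda>t. c j * f (t *s z) $ j) 0 + (deriv ^^ k) (\<lambda>t. \<Sum>j\<in>J. c j * f (t *s z) $ j) 0"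
        using U by (intro higher_deriv_add[where S = ?U] holomorphic_intros hol) auto
      then show ?case
        using insert higher_deriv_cmult[OF hol U(2,1)] by simp
    qed simp
    from this[of UNIV] show ?thesis
      unfolding hpart_vec_def hpart_def vec_lambda_beta
      by (subst (1 2) clinear_component[OF assms(2)]) (simp add: sum_divide_distrib)
  qed
  then show ?thesis by (simp add: vec_eq_iff)
qed

lemma hpart_vec_comp_clinear:
  assumes "clinear L"
  shows "hpart_vec k (\<lambda>z. f (L z)) z = hpart_vec k f (L z)"
  by (simp add: hpart_vec_def hpart_def clinearD(3)[OF assms])

text \<open>Identity theorem by connectedness: the set \<open>U\<close> of points near which the
  maps agree is open, and so is its complement \<open>V\<close> in \<open>S\<close>, because
  agreement near one point of a ball spreads along lines to the whole ball.\<close>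

lemma holomorphic_map_on_eq_linear:
  fixes f :: "complex^'n \<Rightarrow> complex^'k"
  assumes "open S" "connected S" "holomorphic_map_on f S" "clinear A"
    and "0 \<in> S" "0 < s" "\<And>z. norm z < s \<Longrightarrow> f z = A z" and "z \<in> S"
  shows "f z = A z"
proof -
  define U where "U = {z. \<exists>e>0. \<forall>w\<in>ball z e. f w = A w}"
  define V where "V = {z \<in> S. z \<notin> U}"
  have openU: "open U"
    unfolding open_contains_ball
  proof
    fix z assume "z \<in> U"
    then obtain e where e: "e > 0" "\<forall>w\<in>ball z e. f w = A w" by (auto simp: U_def)
    have "ball z (e / 2) \<subseteq> U"
    proof
      fix w assume "w \<in> ball z (e / 2)"
      then have "ball w (e / 2) \<subseteq> ball z e"
        by (smt (verit, best) dist_commute dist_triangle mem_ball subsetI field_sum_of_halves)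
      then show "w \<in> U" using e unfolding U_def by (auto intro!: exI[of _ "e / 2"])
    qed
    then show "\<exists>e>0. ball z e \<subseteq> U" using e(1) by (intro exI[of _ "e / 2"]) auto
  qed
  have propagate: "ball z e \<subseteq> U" if e: "ball z e \<subseteq> S" and u: "u \<in> U" "u \<in> ball z e" for z e u
  proof -
    obtain d where d: "d > 0" "\<forall>w\<in>ball u d. f w = A w" using u by (auto simp: U_def)
    have "f w = A w" if w: "w \<in> ball z e" for w
    proof -
      \<comment> \<open>Parameters of the line through \<open>u\<close> and \<open>w\<close> that
        stay in the ball, and those that are also close to \<open>u\<close>. \<open>?T\<close> is
        convex, so one-variable continuation leads from 0 to 1.\<close>
      let ?T = "{t. u + t *s (w - u) \<in> ball z e}" and ?W = "{t. u + t *s (w - u) \<in> ball u d \<inter> ball z e}"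
      have "f w $ i = A w $ i" for i
      proof -
        have "(\<lambda>t. f (u + t *s (w - u)) $ i) 1 = (\<lambda>t. A (u + t *s (w - u)) $ i) 1"
        proof (rule analytic_continuation_open[of ?W ?T "\<lambda>t. f (u + t *s (w - u)) $ i"
              "\<lambda>t. A (u + t *s (w - u)) $ i" 1])
          have op: "open {t. u + t *s (w - u) \<in> B}" if "open B" for B
            using open_vimage[OF that continuous_on_line[of UNIV u "w - u"]] by (simp only: vimage_def)
          show "open ?W" "open ?T" by (intro op open_Int open_ball)+
          have "0 \<in> ?W" using u d by simp
          then show "?W \<noteq> {}" by blast
          have "convex ?T"
          proof (rule convexI)
            fix x y :: complex and p q :: real
            assume *: "x \<in> ?T" "y \<in> ?T" "0 \<le> p" "0 \<le> q" "p + q = 1"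
            then have q: "q = 1 - p" by simp
            have "u + (p *\<^sub>R x + q *\<^sub>R y) *s (w - u) = p *\<^sub>R (u + x *s (w - u)) + q *\<^sub>R (u + y *s (w - u))"
              unfolding q by (simp add: vec_eq_iff algebra_simps scaleR_conv_of_real[where 'a = complex])
            also have "\<dots> \<in> ball z e"
              using * by (intro convexD[OF convex_ball]) (simp_all only: mem_Collect_eq)
            finally show "p *\<^sub>R x + q *\<^sub>R y \<in> ?T" by (simp only: mem_Collect_eq)
          qed
          then show "connected ?T" by (rule convex_connected)
          have "?T \<subseteq> {t. u + t *s (w - u) \<in> S}" using e by blast
          then show "(\<lambda>t. f (u + t *s (w - u)) $ i) holomorphic_on ?T"
            by (rule holomorphic_on_subset[OF holomorphic_map_on_line[OF assms(3)]])
          show "(\<lambda>t. A (u + t *s (w - u)) $ i) holomorphic_on ?T"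
            using holomorphic_map_on_line[OF clinear_holomorphic[OF assms(4)]] .
          show "?W \<subseteq> ?T" by blast
          show "f (u + t *s (w - u)) $ i = A (u + t *s (w - u)) $ i" if "t \<in> ?W" for t
            using d(2) that by simp
          show "1 \<in> ?T" using w by simp
        qed
        then show ?thesis by simp
      qed
      then show ?thesis by (simp add: vec_eq_iff)
    qed
    then have "\<forall>w\<in>ball z e. f w = A w" by blast
    moreover have "\<exists>e'>0. ball w e' \<subseteq> ball z e" if "w \<in> ball z e" for w
      using that open_ball open_contains_ball by blast
    ultimately show ?thesis unfolding U_def by blast
  qed
  have "open V"
    unfolding open_contains_ball
  proof
    fix z assume z: "z \<in> V"
    then obtain e where e: "e > 0" "ball z e \<subseteq> S"
      using assms(1) unfolding V_def open_contains_ball by blast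
    then have "z \<in> ball z e" by simp
    then have "w \<notin> U" if "w \<in> ball z e" for w
      using propagate[OF e(2) _ that] z unfolding V_def by blast
    then show "\<exists>e>0. ball z e \<subseteq> V" using e unfolding V_def by blast
  qed
  moreover have "0 \<in> U" unfolding U_def using assms(6,7) by (auto intro!: exI[of _ s])
  ultimately have "V \<inter> S = {}"
    using connectedD[OF assms(2) openU, of V] assms(5) unfolding V_def by blast
  then have "z \<in> U" using assms(8) unfolding V_def by blast
  then obtain e where "0 < e" "\<forall>w\<in>ball z e. f w = A w" unfolding U_def by blast
  then show ?thesis by simp
qed

section \<open>Automorphisms fixing the origin\<close>

lemma quasi_rotation_clinear: "clinear (quasi_rotation m \<theta>)"
  by (rule clinearI) (simp_all add: quasi_rotation_def vec_eq_iff algebra_simps)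

lemma quasi_rotation_inverse: "quasi_rotation m (- \<theta>) (quasi_rotation m \<theta> z) = z"
  by (simp add: quasi_rotation_def vec_eq_iff mult.assoc[symmetric] exp_add[symmetric])

lemma quasi_rotation_root_of_unity:
  "quasi_rotation m (2 * pi * real l / real N) z = (\<chi> i. root_of_unity N l ^ m (pos i) * z $ i)"
  "quasi_rotation m (- (2 * pi * real l / real N)) z = (\<chi> i. z $ i / root_of_unity N l ^ m (pos i))"
proof -
  have exp: "exp (\<i> * of_nat p * of_real t) = cis t ^ p" for p t
    unfolding cis_conv_exp exp_of_nat_mult[symmetric] by (simp only: mult_ac)
  show "quasi_rotation m (2 * pi * real l / real N) z = (\<chi> i. root_of_unity N l ^ m (pos i) * z $ i)"
    by (simp only: quasi_rotation_def root_of_unity_def exp)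
  show "quasi_rotation m (- (2 * pi * real l / real N)) z = (\<chi> i. z $ i / root_of_unity N l ^ m (pos i))"
    unfolding quasi_rotation_def root_of_unity_def exp cis_inverse[symmetric] power_inverse
    by (simp only: divide_inverse mult.commute)
qed

text \<open>Conjugation divides component \<open>i\<close> by the root to the power
  \<open>m (pos i)\<close>, so \<open>hom_poly_average_eq_zero\<close> applies with
  \<open>d = m (pos i)\<close>; the same angles work for all components.\<close>

lemma quasi_rotation_average_eq_zero:
  fixes P :: "complex^'n::{finite,linorder} \<Rightarrow> complex^'n::{finite,linorder}"
  assumes "\<And>i. hom_poly k (\<lambda>z. P z $ i)"
    and "\<And>(i::'n) \<alpha>. sum \<alpha> UNIV = k \<Longrightarrow> m (pos i) \<noteq> (\<Sum>j\<in>UNIV. m (pos (j::'n)) * \<alpha> j)"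
  obtains \<theta> :: "nat \<Rightarrow> real" and N :: nat where "0 < N"
    "\<And>z. (\<Sum>l<N. quasi_rotation m (- \<theta> l) (P (quasi_rotation m (\<theta> l) z))) = 0"
proof
  define W where "W = (\<Sum>j\<in>UNIV. m (pos (j::'n)))"
  \<comment> \<open>Exceeds \<open>m (pos i) + k * W\<close> for every \<open>i\<close>, as
    \<open>m (pos i) \<le> W\<close>.\<close>
  define N where "N = Suc (W + k * W)"
  show "0 < N" by (simp add: N_def)
  fix z
  have "(\<Sum>l<N. P (\<chi> j. root_of_unity N l ^ m (pos j) * z $ j) $ i / root_of_unity N l ^ m (pos i)) = 0" for i
  proof (rule hom_poly_average_eq_zero[OF assms])
    have "m (pos i) \<le> W" unfolding W_def by (rule member_le_sum) auto
    then show "m (pos i) + k * (\<Sum>j\<in>UNIV. m (pos (j::'n))) < N" by (simp add: N_def W_def)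
  qed
  then show "(\<Sum>l<N. quasi_rotation m (- (2 * pi * real l / real N)) (P (quasi_rotation m (2 * pi * real l / real N) z))) = 0"
    unfolding quasi_rotation_root_of_unity by (simp add: vec_eq_iff)
qed

text \<open>The inverse is carried as a second argument, so that its derivative at 0 is at hand and
  composites come with their inverses.\<close>

definition aut :: "(complex^'n) set \<Rightarrow> (complex^'n \<Rightarrow> complex^'n) \<Rightarrow> (complex^'n \<Rightarrow> complex^'n) \<Rightarrow> bool" where
  "aut D \<phi> \<psi> \<longleftrightarrow> holomorphic_map_on \<phi> D \<and> holomorphic_map_on \<psi> D \<and> \<phi> ` D \<subseteq> D \<and> \<psi> ` D \<subseteq> D \<and>
     (\<forall>z\<in>D. \<psi> (\<phi> z) = z \<and> \<phi> (\<psi> z) = z) \<and> \<phi> 0 = 0 \<and> \<psi> 0 = 0"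

lemma aut_sym: "aut D \<phi> \<psi> \<Longrightarrow> aut D \<psi> \<phi>"
  by (auto simp: aut_def)

lemma aut_compose:
  assumes "aut D \<phi> \<psi>" "aut D \<phi>' \<psi>'"
  shows "aut D (\<lambda>z. \<phi> (\<phi>' z)) (\<lambda>z. \<psi>' (\<psi> z))"
proof -
  have "holomorphic_map_on (\<lambda>z. \<phi> (\<phi>' z)) D" "holomorphic_map_on (\<lambda>z. \<psi>' (\<psi> z)) D"
    using assms by (auto simp: aut_def intro: holomorphic_map_on_compose)
  moreover have "(\<lambda>z. \<phi> (\<phi>' z)) ` D \<subseteq> D" "(\<lambda>z. \<psi>' (\<psi> z)) ` D \<subseteq> D"
    using assms unfolding aut_def by blast+
  moreover have "\<forall>z\<in>D. \<psi>' (\<psi> (\<phi> (\<phi>' z))) = z \<and> \<phi> (\<phi>' (\<psi>' (\<psi> z))) = z"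
    using assms unfolding aut_def by (metis image_subset_iff)
  ultimately show ?thesis
    using assms unfolding aut_def by simp
qed

context
  fixes D :: "(complex^'n::{finite,linorder}) set" and r M :: real and m :: "nat \<Rightarrow> nat"
  assumes r: "0 < r" "ball 0 r \<subseteq> D"
    and M: "\<And>z. z \<in> D \<Longrightarrow> norm z \<le> M"
    and inv: "\<And>\<theta>. quasi_rotation m \<theta> ` D = D"
    and nores: "\<And>(i::'n) \<alpha>. 2 \<le> sum \<alpha> UNIV \<Longrightarrow> m (pos i) \<noteq> (\<Sum>j\<in>UNIV. m (pos (j::'n)) * \<alpha> j)"
begin

text \<open>Automorphisms map the bounded set \<open>D\<close> into itself, so one radius and one
  bound serve them all, and Cauchy's estimates are uniform over the group.\<close>

lemma aut_germ:
  assumes "aut D \<phi> \<psi>" shows "germ r M \<phi>"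
proof (rule holomorphic_map_on_germ)
  show "norm (\<phi> z) \<le> M" if "z \<in> D" for z
    using assms that M unfolding aut_def by blast
qed (use assms r in \<open>auto simp: aut_def\<close>)

lemma aut_hpart_vec_1_inverse:
  assumes "aut D \<phi> \<psi>" shows "hpart_vec 1 \<psi> (hpart_vec 1 \<phi> z) = z"
proof -
  have "hpart_vec 1 (\<lambda>z. \<psi> (\<phi> z)) = hpart_vec 1 (\<lambda>z. z)"
    by (rule hpart_vec_cong[of r]) (use assms r in \<open>auto simp: aut_def\<close>)
  also have "\<dots> = (\<lambda>z. z)" by (rule hpart_vec_1_clinear) (simp add: clinearI)
  finally show ?thesis
    using hpart_vec_1_compose[OF aut_germ[OF assms] aut_germ[OF aut_sym[OF assms]]] by metis
qed

lemma aut_quasi_rotation: "aut D (quasi_rotation m \<theta>) (quasi_rotation m (- \<theta>))"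
proof -
  have "quasi_rotation m \<theta> (quasi_rotation m (- \<theta>) z) = z" for z :: "complex^'n::{finite,linorder}"
    using quasi_rotation_inverse[of m "- \<theta>"] by simp
  then show ?thesis
    unfolding aut_def
    using clinear_holomorphic[OF quasi_rotation_clinear] inv quasi_rotation_inverse
      clinearD(4)[OF quasi_rotation_clinear] by auto
qed

text \<open>
  The maps \<open>c \<phi>\<close>, the derivative at \<open>0\<close> inverted and applied to the part of degree \<open>k\<close>, form a
  cocycle that is bounded because \<open>D\<close> is, and that vanishes on the rotations. Composing any \<open>g\<close>
  with \<open>h\<close> and a rotation changes \<open>c g\<close> by a term whose mean over the rotations is zero, so by
  Pythagoras it increases the mean square of \<open>c g\<close> at the nodes by at least a constant, unless
  \<open>c h = 0\<close>.
\<close>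

lemma aut_hpart_vec_step:
  assumes k: "2 \<le> k"
    and IH: "\<And>j \<phi> \<psi> z. 2 \<le> j \<Longrightarrow> j < k \<Longrightarrow> aut D \<phi> \<psi> \<Longrightarrow> hpart_vec j \<phi> z = 0"
    and h: "aut D h h'"
  shows "hpart_vec k h z0 = 0"
proof (rule ccontr)
  assume nz: "hpart_vec k h z0 \<noteq> 0"
  define c where "c \<phi> \<psi> z = hpart_vec 1 \<psi> (hpart_vec k \<phi> z)" for \<phi> \<psi> :: "complex^'n::{finite,linorder} \<Rightarrow> complex^'n::{finite,linorder}" and z
  define R where "R \<theta> = (quasi_rotation m \<theta> :: complex^'n::{finite,linorder} \<Rightarrow> complex^'n::{finite,linorder})" for \<theta>
  have R: "aut D (R \<theta>) (R (- \<theta>))" "clinear (R \<theta>)" "hpart_vec 1 (R \<theta>) = R \<theta>" "hpart_vec k (R \<theta>) z = 0" for \<theta> z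
    unfolding R_def using k
    by (auto intro: aut_quasi_rotation quasi_rotation_clinear hpart_vec_1_clinear hpart_vec_clinear simp del: One_nat_def)
  have lin: "clinear (hpart_vec 1 \<phi>)" if "aut D \<phi> \<psi>" for \<phi> \<psi>
    using hpart_vec_1_germ(1)[OF aut_germ[OF that]] .
  have comp1: "hpart_vec 1 (\<lambda>z. \<phi> (\<phi>' z)) = (\<lambda>z. hpart_vec 1 \<phi> (hpart_vec 1 \<phi>' z))"
    if "aut D \<phi> \<psi>" "aut D \<phi>' \<psi>'" for \<phi> \<psi> \<phi>' \<psi>'
    using hpart_vec_1_compose[OF aut_germ[OF that(2)] aut_germ[OF that(1)]] .
  \<comment> \<open>\<open>IH\<close> removes the intermediate degrees of both maps and of their
    composite.\<close>
  have compk: "hpart_vec k (\<lambda>z. \<phi> (\<phi>' z)) z = hpart_vec 1 \<phi> (hpart_vec k \<phi>' z) + hpart_vec k \<phi> (hpart_vec 1 \<phi>' z)"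
    if a: "aut D \<phi> \<psi>" "aut D \<phi>' \<psi>'" for \<phi> \<psi> \<phi>' \<psi>' z
    by (rule hpart_vec_compose[OF aut_germ[OF a(2)] aut_germ[OF a(1)] aut_germ[OF aut_compose[OF a]] k])
      (use IH a aut_compose[OF a] in blast)+
  \<comment> \<open>In the first term of \<open>compk\<close> the derivatives of
    \<open>\<phi>\<close> and \<open>\<psi>\<close> cancel; the second is
    \<open>c \<phi> \<psi>\<close> conjugated by the derivative of \<open>\<phi>'\<close>.\<close>
  have cocycle: "c (\<lambda>z. \<phi> (\<phi>' z)) (\<lambda>z. \<psi>' (\<psi> z)) z = c \<phi>' \<psi>' z + hpart_vec 1 \<psi>' (c \<phi> \<psi> (hpart_vec 1 \<phi>' z))"
    if a: "aut D \<phi> \<psi>" "aut D \<phi>' \<psi>'" for \<phi> \<psi> \<phi>' \<psi>' z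
    unfolding c_def comp1[OF aut_sym[OF a(2)] aut_sym[OF a(1)]] compk[OF a]
    by (simp only: clinearD(1)[OF lin[OF aut_sym[OF a(1)]]] clinearD(1)[OF lin[OF aut_sym[OF a(2)]]]
        aut_hpart_vec_1_inverse[OF a(1)])
  have chom: "hom_poly k (\<lambda>z. c \<phi> \<psi> z $ i)" if a: "aut D \<phi> \<psi>" for \<phi> \<psi> i
    unfolding c_def by (rule hom_poly_clinear_comp[OF lin[OF aut_sym[OF a]] hom_poly_hpart_vec[OF aut_germ[OF a]]])
  have M0: "0 \<le> M" using M[of 0] subsetD[OF r(2), of 0] r(1) by simp
  \<comment> \<open>Cauchy's bound in degree 1, made positive so that one can divide by it.\<close>
  define C1 where "C1 = real CARD('n) * M * (2 / r) ^ 1 + 1"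
  have C1: "0 < C1" "norm (hpart_vec 1 \<phi> z) \<le> C1 * norm z" if "aut D \<phi> \<psi>" for \<phi> \<psi> z
  proof -
    have "0 \<le> real CARD('n) * M * (2 / r) ^ 1" using M0 r by simp
    then show "0 < C1" by (simp add: C1_def add_nonneg_pos)
    have "norm (hpart_vec 1 \<phi> z) \<le> real CARD('n) * M * (2 / r) ^ 1 * norm z ^ 1"
      by (rule norm_hpart_vec[OF aut_germ[OF that]])
    also have "\<dots> \<le> C1 * norm z" unfolding C1_def by (simp add: algebra_simps)
    finally show "norm (hpart_vec 1 \<phi> z) \<le> C1 * norm z" .
  qed
  have C1_pos: "0 < C1" using C1(1)[OF h] .
  define X where "X = (node_indices (Suc k) :: ('n \<Rightarrow> nat) set)"
  define nd where "nd x = (node (Suc k) x :: complex^'n::{finite,linorder})" for x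
  have finX: "finite X" unfolding X_def by (intro finite_PiE) auto
  \<comment> \<open>The mean square up to a constant factor; by interpolation the values at the
    nodes determine the polynomial.\<close>
  define E where "E \<phi> \<psi> = (\<Sum>x\<in>X. (norm (c \<phi> \<psi> (nd x)))\<^sup>2)" for \<phi> \<psi>
  \<comment> \<open>The change of the cocycle when \<open>\<phi>\<close> is followed by
    \<open>h\<close>.\<close>
  define w where "w \<phi> \<psi> z = hpart_vec 1 \<psi> (c h h' (hpart_vec 1 \<phi> z))"
    for \<phi> \<psi> :: "complex^'n::{finite,linorder} \<Rightarrow> complex^'n::{finite,linorder}" and z

  obtain Bd where Bd: "\<And>\<phi> \<psi>. aut D \<phi> \<psi> \<Longrightarrow> E \<phi> \<psi> \<le> Bd"
  proof
    fix \<phi> \<psi> assume a: "aut D \<phi> \<psi>"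
    have "norm (c \<phi> \<psi> z) \<le> C1 * (real CARD('n) * M * (2 / r) ^ k * norm z ^ k)" for z
      unfolding c_def using norm_hpart_vec[OF aut_germ[OF a], of k z] C1_pos
      by (intro order_trans[OF C1(2)[OF aut_sym[OF a]]] mult_left_mono) auto
    then show "E \<phi> \<psi> \<le> (\<Sum>x\<in>X. (C1 * (real CARD('n) * M * (2 / r) ^ k * norm (nd x) ^ k))\<^sup>2)"
      unfolding E_def by (intro sum_mono power_mono) auto
  qed

  \<comment> \<open>The increment cannot be small at all nodes: interpolation would make it small at
    \<open>y\<close>, the preimage of \<open>z0\<close> under the derivative of
    \<open>\<phi>\<close>, while that derivative maps the increment at \<open>y\<close> to the
    nonzero \<open>c h h' z0\<close>. \<open>C1\<close> and \<open>B\<close> make this uniform in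
    \<open>\<phi>\<close>.\<close>
  obtain \<delta> where \<delta>: "0 < \<delta>" "\<And>\<phi> \<psi>. aut D \<phi> \<psi> \<Longrightarrow> \<delta> \<le> (\<Sum>x\<in>X. (norm (w \<phi> \<psi> (nd x)))\<^sup>2)"
  proof -
    obtain B where B: "0 < B" "\<And>x (z :: complex^'n::{finite,linorder}). norm z \<le> C1 * norm z0 \<Longrightarrow> norm (kernel (Suc k) x z) \<le> B"
      using kernel_bound by metis
    have "c h h' z0 \<noteq> 0"
    proof
      assume "c h h' z0 = 0"
      then have "hpart_vec 1 h (hpart_vec 1 h' (hpart_vec k h z0)) = hpart_vec 1 h 0" by (simp only: c_def)
      then show False
        using nz aut_hpart_vec_1_inverse[OF aut_sym[OF h]] clinearD(4)[OF lin[OF h]] by metis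
    qed
    define \<eta> where "\<eta> = norm (c h h' z0) / (C1 * B)"
    have "0 < \<eta>" using \<open>c h h' z0 \<noteq> 0\<close> C1_pos B(1) by (simp add: \<eta>_def)
    have cardX: "0 < card X"
      using finX by (auto simp: X_def card_gt_0_iff PiE_eq_empty_iff)
    have low: "\<eta>\<^sup>2 / card X \<le> (\<Sum>x\<in>X. (norm (w \<phi> \<psi> (nd x)))\<^sup>2)" if a: "aut D \<phi> \<psi>" for \<phi> \<psi>
    proof -
      define y where "y = hpart_vec 1 \<psi> z0"
      have y: "norm y \<le> C1 * norm z0" unfolding y_def by (rule C1(2)[OF aut_sym[OF a]])
      have hom: "hom_poly k (\<lambda>z. w \<phi> \<psi> z $ i)" for i
        unfolding w_def
        by (rule hom_poly_clinear_comp[OF lin[OF aut_sym[OF a]] hom_poly_linear[OF chom[OF h] lin[OF a]]])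
      have "w \<phi> \<psi> y = (\<Sum>x\<in>X. kernel (Suc k) x y *s w \<phi> \<psi> (nd x))"
        using hom_poly_interpolation[OF hom, of y] by (simp add: vec_eq_iff X_def nd_def)
      also have "norm \<dots> \<le> (\<Sum>x\<in>X. B * norm (w \<phi> \<psi> (nd x)))"
        by (rule order_trans[OF norm_sum], rule sum_mono)
          (use B(2)[OF y] in \<open>simp add: norm_vector_smult mult_right_mono\<close>)
      finally have wy: "norm (w \<phi> \<psi> y) \<le> B * (\<Sum>x\<in>X. norm (w \<phi> \<psi> (nd x)))"
        by (simp add: sum_distrib_left)
      have "c h h' z0 = hpart_vec 1 \<phi> (w \<phi> \<psi> y)"
        unfolding w_def y_def by (simp only: aut_hpart_vec_1_inverse[OF aut_sym[OF a]])
      then have "norm (c h h' z0) \<le> C1 * norm (w \<phi> \<psi> y)" using C1(2)[OF a] by simp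
      also have "\<dots> \<le> C1 * (B * (\<Sum>x\<in>X. norm (w \<phi> \<psi> (nd x))))"
        using wy C1_pos by (intro mult_left_mono) auto
      finally have "\<eta> \<le> (\<Sum>x\<in>X. norm (w \<phi> \<psi> (nd x)))"
        using C1_pos B(1) by (simp add: \<eta>_def pos_divide_le_eq mult_ac)
      then have "\<eta>\<^sup>2 \<le> (\<Sum>x\<in>X. norm (w \<phi> \<psi> (nd x)))\<^sup>2"
        using \<open>0 < \<eta>\<close> by (intro power_mono) auto
      \<comment> \<open>Cauchy-Schwarz, which accounts for the factor \<open>card X\<close>.\<close>
      also have "\<dots> \<le> (\<Sum>x\<in>X. (norm (w \<phi> \<psi> (nd x)))\<^sup>2) * card X"
        by (rule sum_squared_le_sum_of_squares)
      finally show ?thesis using cardX by (simp add: pos_divide_le_eq)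
    qed
    show ?thesis
      by (rule that[OF _ low]) (use \<open>0 < \<eta>\<close> cardX in auto)
  qed

  obtain \<theta> :: "nat \<Rightarrow> real" and N where N: "0 < N"
    and avg: "\<And>z. (\<Sum>l<N. R (- \<theta> l) (c h h' (R (\<theta> l) z))) = 0"
    unfolding R_def
    by (rule quasi_rotation_average_eq_zero[of k "c h h'" m]) (use chom[OF h] nores k in auto)

  \<comment> \<open>The candidates are \<open>h\<close> after a rotation after
    \<open>\<phi>\<close>, one for each angle. Their values of \<open>E\<close> average to at least
    \<open>E \<phi> \<psi> + \<delta>\<close>, so they cannot all be smaller.\<close>
  have grow: "\<exists>\<phi>' \<psi>'. aut D \<phi>' \<psi>' \<and> E \<phi> \<psi> + \<delta> \<le> E \<phi>' \<psi>'" if a: "aut D \<phi> \<psi>" for \<phi> \<psi>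
  proof (rule ccontr)
    assume neg: "\<not> ?thesis"
    define \<phi>1 \<psi>1 where "\<phi>1 l = (\<lambda>z. R (\<theta> l) (\<phi> z))" and "\<psi>1 l = (\<lambda>z. \<psi> (R (- \<theta> l) z))" for l
    have a1: "aut D (\<phi>1 l) (\<psi>1 l)" for l
      unfolding \<phi>1_def \<psi>1_def by (rule aut_compose[OF R(1) a])
    have a2: "aut D (\<lambda>z. h (\<phi>1 l z)) (\<lambda>z. \<psi>1 l (h' z))" for l
      by (rule aut_compose[OF h a1])
    \<comment> \<open>Rotations are linear, so following \<open>\<phi>\<close> by one leaves the
      cocycle unchanged.\<close>
    have c1: "c (\<phi>1 l) (\<psi>1 l) z = c \<phi> \<psi> z" for l z
    proof -
      have "c (R (\<theta> l)) (R (- \<theta> l)) z = 0" for z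
        unfolding c_def R by (rule clinearD(4)[OF R(2)])
      then show ?thesis
        unfolding \<phi>1_def \<psi>1_def cocycle[OF R(1) a] by (simp only: clinearD(4)[OF lin[OF aut_sym[OF a]]] add_0_right)
    qed
    have c2: "c (\<lambda>z. h (\<phi>1 l z)) (\<lambda>z. \<psi>1 l (h' z)) z = c \<phi> \<psi> z + w (\<phi>1 l) (\<psi>1 l) z" for l z
      unfolding cocycle[OF h a1] c1 w_def ..
    have "w (\<phi>1 l) (\<psi>1 l) z = hpart_vec 1 \<psi> (R (- \<theta> l) (c h h' (R (\<theta> l) (hpart_vec 1 \<phi> z))))" for l z
      unfolding w_def \<phi>1_def \<psi>1_def comp1[OF R(1) a] comp1[OF aut_sym[OF a] aut_sym[OF R(1)]] R(3) ..
    \<comment> \<open>The derivative of \<open>\<psi>\<close> passes through the sum, and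
      \<open>avg\<close> applies at the image of \<open>z\<close> under the derivative of
      \<open>\<phi>\<close>.\<close>
    then have w0: "(\<Sum>l<N. w (\<phi>1 l) (\<psi>1 l) z) = 0" for z
      by (simp only: clinearD(5)[OF lin[OF aut_sym[OF a]], symmetric] avg clinearD(4)[OF lin[OF aut_sym[OF a]]])
    \<comment> \<open>The cross terms add up to an inner product with the zero sum.\<close>
    have pyth: "(\<Sum>l<N. (norm (u + v l))\<^sup>2) = real N * (norm u)\<^sup>2 + (\<Sum>l<N. (norm (v l))\<^sup>2)"
      if "(\<Sum>l<N. v l) = 0" for u and v :: "nat \<Rightarrow> complex^'n::{finite,linorder}"
    proof -
      have "(norm (u + v l))\<^sup>2 = (norm u)\<^sup>2 + 2 * inner u (v l) + (norm (v l))\<^sup>2" for l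
        by (simp add: power2_norm_eq_inner inner_add inner_commute)
      then have "(\<Sum>l<N. (norm (u + v l))\<^sup>2) = (\<Sum>l<N. (norm u)\<^sup>2) + 2 * inner u (\<Sum>l<N. v l) + (\<Sum>l<N. (norm (v l))\<^sup>2)"
        by (simp only: sum.distrib inner_sum_right sum_distrib_left)
      then show ?thesis using that by simp
    qed
    have "(\<Sum>l<N. E (\<lambda>z. h (\<phi>1 l z)) (\<lambda>z. \<psi>1 l (h' z))) < (\<Sum>l<N. E \<phi> \<psi> + \<delta>)"
      using neg a2 N by (intro sum_strict_mono) (auto simp: not_le)
    also have "\<dots> = real N * E \<phi> \<psi> + (\<Sum>l<N. \<delta>)" by (simp add: algebra_simps)
    also have "\<dots> \<le> real N * E \<phi> \<psi> + (\<Sum>l<N. \<Sum>x\<in>X. (norm (w (\<phi>1 l) (\<psi>1 l) (nd x)))\<^sup>2)"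
      using \<delta>(2)[OF a1] by (intro add_left_mono sum_mono)
    also have "\<dots> = (\<Sum>x\<in>X. real N * (norm (c \<phi> \<psi> (nd x)))\<^sup>2 + (\<Sum>l<N. (norm (w (\<phi>1 l) (\<psi>1 l) (nd x)))\<^sup>2))"
      unfolding E_def sum.distrib sum_distrib_left by (subst sum.swap) simp
    also have "\<dots> = (\<Sum>x\<in>X. \<Sum>l<N. (norm (c \<phi> \<psi> (nd x) + w (\<phi>1 l) (\<psi>1 l) (nd x)))\<^sup>2)"
      by (simp only: pyth[OF w0])
    also have "\<dots> = (\<Sum>l<N. E (\<lambda>z. h (\<phi>1 l z)) (\<lambda>z. \<psi>1 l (h' z)))"
      unfolding E_def c2 by (rule sum.swap)
    finally show False by simp
  qed

  \<comment> \<open>Iterating \<open>grow\<close> drives \<open>E\<close> past the bound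
    \<open>Bd\<close>.\<close>
  have "\<exists>\<phi> \<psi>. aut D \<phi> \<psi> \<and> real n * \<delta> \<le> E \<phi> \<psi>" for n
  proof (induction n)
    case 0
    have "0 \<le> E h h'" unfolding E_def by (intro sum_nonneg) simp
    then show ?case using h by auto
  next
    case (Suc n)
    then obtain \<phi> \<psi> where 1: "aut D \<phi> \<psi>" "real n * \<delta> \<le> E \<phi> \<psi>" by blast
    obtain \<phi>' \<psi>' where 2: "aut D \<phi>' \<psi>'" "E \<phi> \<psi> + \<delta> \<le> E \<phi>' \<psi>'" using grow[OF 1(1)] by blast
    have "real (Suc n) * \<delta> \<le> E \<phi>' \<psi>'" using 1(2) 2(2) by (simp add: algebra_simps)
    then show ?case using 2(1) by blast
  qed
  moreover obtain n where "Bd < real n * \<delta>" using reals_Archimedean3[OF \<delta>(1)] by blast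
  ultimately show False using Bd by (metis not_le order_trans)
qed

lemma aut_hpart_vec_eq_zero:
  assumes "2 \<le> k" "aut D \<phi> \<psi>"
  shows "hpart_vec k \<phi> z = 0"
  using assms
proof (induction k arbitrary: \<phi> \<psi> z rule: less_induct)
  case (less k)
  then show ?case using aut_hpart_vec_step[of k \<phi> \<psi> z] by blast
qed

lemma aut_linear_near_0:
  assumes "aut D \<phi> \<psi>" "norm z < r"
  shows "\<phi> z = hpart_vec 1 \<phi> z"
  using germ_eq_linear[OF aut_germ[OF assms(1)] aut_hpart_vec_eq_zero[OF _ assms(1)] assms(2)] .

end

section \<open>Biholomorphisms\<close>

theorem theorem3p1:
  fixes D D' :: "(complex^'n::{finite,linorder}) set"
    and m m' :: "nat \<Rightarrow> nat"
    and f :: "complex^'n::{finite,linorder} \<Rightarrow> complex^'n::{finite,linorder}"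
  assumes "2 \<le> CARD('n)"
    and "bounded D" and "0 \<in> D" and "quasi_circular m D" and "m \<in> L_set CARD('n)"
    and "bounded D'" and "0 \<in> D'" and "quasi_circular m' D'" and "m' \<in> L_set CARD('n)"
    and "biholomorphism_on f D D'" and "f 0 = 0"
  shows "\<exists>A :: complex^'n::{finite,linorder} \<Rightarrow> complex^'n::{finite,linorder}.
           Vector_Spaces.linear (*s) (*s) A \<and> (\<forall>z\<in>D. f z = A z)"
proof -
  have D: "open D" "connected D" "is_weight CARD('n) m" "\<And>\<theta>. quasi_rotation m \<theta> ` D = D"
    and D': "open D'" "is_weight CARD('n) m'" "\<And>\<theta>. quasi_rotation m' \<theta> ` D' = D'"
    using assms(4,8) by (auto simp: quasi_circular_def)
  define g where "g = inv_into D f"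
  have bij: "bij_betw f D D'" and hol: "holomorphic_map_on f D" "holomorphic_map_on g D'"
    using assms(10) by (auto simp: biholomorphism_on_def g_def)
  have gf: "g (f z) = z" if "z \<in> D" for z
    using bij that by (simp add: g_def bij_betw_inv_into_left)
  have fg: "f (g z) = z" if "z \<in> D'" for z
    using bij that by (simp add: g_def bij_betw_inv_into_right)
  have img: "f ` D \<subseteq> D'" "g ` D' \<subseteq> D"
    using bij bij_betw_inv_into[OF bij] by (auto simp: bij_betw_def g_def)
  have g0: "g 0 = 0" using gf[OF assms(3)] assms(11) by simp
  obtain r r' where r: "0 < r" "ball 0 r \<subseteq> D" and r': "0 < r'" "ball 0 r' \<subseteq> D'"
    using D(1) D'(1) assms(3,7) by (meson open_contains_ball)
  obtain M M' where M: "\<And>z. z \<in> D \<Longrightarrow> norm z \<le> M" and M': "\<And>z. z \<in> D' \<Longrightarrow> norm z \<le> M'"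
    using assms(2,6) by (auto simp: bounded_iff)
  have germf: "germ r M' f"
    using img M' by (intro holomorphic_map_on_germ[OF hol(1) r(2,1) assms(11)]) blast
  have germg: "germ r' M g"
    using img M by (intro holomorphic_map_on_germ[OF hol(2) r'(2,1) g0]) blast
  define A B where "A = hpart_vec 1 f" and "B = hpart_vec 1 g"
  have lin: "clinear A" "clinear B"
    unfolding A_def B_def by (rule hpart_vec_1_germ(1)[OF germf] hpart_vec_1_germ(1)[OF germg])+
  have id: "hpart_vec 1 (\<lambda>z. z) = (\<lambda>z. z :: complex^'n::{finite,linorder})"
    by (rule hpart_vec_1_clinear) (simp add: clinearI)
  have "hpart_vec 1 (\<lambda>z. g (f z)) = hpart_vec 1 (\<lambda>z. z)"
    by (rule hpart_vec_cong[OF _ r(1)]) (use gf r(2) in auto)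
  then have BA: "B (A z) = z" for z
    using hpart_vec_1_compose[OF germf germg] unfolding id A_def B_def by metis
  have "hpart_vec 1 (\<lambda>z. f (g z)) = hpart_vec 1 (\<lambda>z. z)"
    by (rule hpart_vec_cong[OF _ r'(1)]) (use fg r'(2) in auto)
  then have AB: "A (B z) = z" for z
    using hpart_vec_1_compose[OF germg germf] unfolding id A_def B_def by metis

  define R where "R \<theta> = (quasi_rotation m' \<theta> :: complex^'n::{finite,linorder} \<Rightarrow> complex^'n::{finite,linorder})" for \<theta>
  have R: "clinear (R \<theta>)" "R (- \<theta>) (R \<theta> z) = z" "R \<theta> (R (- \<theta>) z) = z" for \<theta> z
    using quasi_rotation_inverse[of m' \<theta> z] quasi_rotation_inverse[of m' "- \<theta>" z]
    by (auto simp: R_def quasi_rotation_clinear)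
  have RD: "R \<theta> z \<in> D'" if "z \<in> D'" for \<theta> z
    using D'(3)[of \<theta>] that by (auto simp: R_def)
  \<comment> \<open>The rotations of \<open>D'\<close> transported to \<open>D\<close>; the opposite
    angle gives the inverse.\<close>
  define F where "F \<theta> z = g (R \<theta> (f z))" for \<theta> z
  have holF: "holomorphic_map_on (F \<theta>) D" for \<theta>
    unfolding F_def
    by (rule holomorphic_map_on_compose[OF holomorphic_map_on_compose[OF hol(1) clinear_holomorphic[OF R(1)]] hol(2)])
      (use img RD in auto)
  have FD: "F \<theta> z \<in> D" and FF: "F (- \<theta>) (F \<theta> z) = z" "F \<theta> (F (- \<theta>) z) = z" if "z \<in> D" for \<theta> z
    using that img RD[of "f z"] by (auto simp: F_def fg gf R image_subset_iff)
  have autF: "aut D (F \<theta>) (F (- \<theta>))" for \<theta>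
    using holF FD FF assms(11) g0 clinearD(4)[OF R(1)] by (auto simp: aut_def F_def)
  define L where "L \<theta> z = B (R \<theta> (A z))" for \<theta> z
  have "germ r M' (\<lambda>z. R \<theta> (f z))" for \<theta>
    using img M' RD clinearD(4)[OF R(1)] assms(11)
    by (intro holomorphic_map_on_germ[OF holomorphic_map_on_compose[OF hol(1) clinear_holomorphic[OF R(1)]] r(2,1)])
      auto
  then have "hpart_vec 1 (F \<theta>) = (\<lambda>z. B (hpart_vec 1 (\<lambda>z. R \<theta> (f z)) z))" for \<theta>
    unfolding F_def B_def by (rule hpart_vec_1_compose[OF _ germg])
  then have hpF: "hpart_vec 1 (F \<theta>) = L \<theta>" for \<theta>
    unfolding fun_eq_iff L_def A_def hpart_vec_clinear_comp[OF germf R(1)] by blast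
  \<comment> \<open>The weight of \<open>D\<close> enters here: it forces the automorphism
    \<open>F \<theta>\<close> to be linear near 0.\<close>
  have near: "F \<theta> z = L \<theta> z" if "norm z < r" for \<theta> z
    unfolding hpF[symmetric]
    by (rule aut_linear_near_0[OF r M D(4) L_set_no_resonance[OF assms(5) D(3)] autF that])
  have fL: "f (L \<theta> z) = R \<theta> (f z)" if "norm z < r" for \<theta> z
  proof -
    have "z \<in> D" using that r(2) by auto
    then have "R \<theta> (f z) \<in> D'" using img(1) RD by blast
    then show ?thesis
      using near[OF that, of \<theta>] fg unfolding F_def by metis
  qed
  have linL: "clinear (L \<theta>)" for \<theta>
    unfolding L_def by (rule clinear_compose[OF clinear_compose[OF lin(1) R(1)] lin(2)])

  have hp0: "hpart_vec k f z = 0" if k: "2 \<le> k" for k z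
  proof -
    \<comment> \<open>Precomposing with \<open>B\<close> turns \<open>L \<theta>\<close> into
      \<open>R \<theta>\<close>, so comparing degree \<open>k\<close> in \<open>fL\<close> shows
      that \<open>Q\<close> commutes with the rotations of \<open>D'\<close>.\<close>
    define Q where "Q y = hpart_vec k f (B y)" for y
    have equiv: "Q (R \<theta> y) = R \<theta> (Q y)" for \<theta> y
    proof -
      have "hpart_vec k (\<lambda>z. f (L \<theta> z)) = hpart_vec k (\<lambda>z. R \<theta> (f z))"
        by (rule hpart_vec_cong[OF fL r(1)])
      then have "hpart_vec k f (L \<theta> z) = R \<theta> (hpart_vec k f z)" for z
        by (simp only: fun_eq_iff hpart_vec_comp_clinear[OF linL] hpart_vec_clinear_comp[OF germf R(1)])
      from this[of "B y"] show ?thesis by (simp add: Q_def L_def AB)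
    qed
    have homQ: "hom_poly k (\<lambda>y. Q y $ i)" for i
      unfolding Q_def by (rule hom_poly_linear[OF hom_poly_hpart_vec[OF germf] lin(2)])
    \<comment> \<open>The weight of \<open>D'\<close> enters here: the conjugates of
      \<open>Q\<close> sum to zero, while by \<open>equiv\<close> each of them equals
      \<open>Q\<close>.\<close>
    obtain \<theta> :: "nat \<Rightarrow> real" and N where N: "0 < N"
      and avg: "\<And>y. (\<Sum>l<N. R (- \<theta> l) (Q (R (\<theta> l) y))) = 0"
      unfolding R_def
      by (rule quasi_rotation_average_eq_zero[of k Q m'])
        (use homQ L_set_no_resonance[OF assms(9) D'(2)] k in auto)
    have "real N *\<^sub>R Q y = 0" for y
      using avg[of y] by (simp only: equiv R sum_constant_scaleR card_lessThan)
    then have "Q (A z) = 0" using N by auto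
    then show ?thesis by (simp add: Q_def BA)
  qed
  have "f z = A z" if "norm z < r" for z
    unfolding A_def by (rule germ_eq_linear[OF germf hp0 that])
  then have "\<forall>z\<in>D. f z = A z"
    using holomorphic_map_on_eq_linear[OF D(1,2) hol(1) lin(1) assms(3) r(1)] by blast
  with lin(1) show ?thesis by blast
qed

end
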